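(* Let $X$ and $Y$ be locally compact Hausdorff spaces, $n$ a positive integer, and $P: C_0(X)\to C_0(Y)$ an orthogonally additive $n$-homogeneous polynomial. Assume that $P$ is an $n$-isometry on positive elements, i.e. $\|P(f)\|=\|f\|^n$ for all $f\in C_0(X)_+$, and that its range $P(C_0(X))$ is regular. Then there exist a continuous unimodular scalar function $h$ on $Y$ (i.e. $|h(y)|=1$ for all $y\in Y$) and a homeomorphism $\varphi: Y\to X$ such that $$ P(f)(y) = h(y)\,(f(\varphi(y)))^n, \qquad \forall f \in C_0(X),\ \forall y \in Y. $$
   Context: $C_0(X)$ is the C*-algebra of continuous complex-valued functions on $X$ vanishing at infinity with the sup norm, and $C_0(X)_+$ its set of nonnegative functions. An $n$-homogeneous polynomial $P:E\to F$ is a map $P(x)=L(x,\dots,x)$ with $L:E\times\cdots\times E\to F$ a symmetric $n$-linear operator. $P$ is orthogonally additive if $fg=0$ implies $P(f+g)=P(f)+P(g)$ for all $f,g\in C_0(X)$. A subset $F$ of $C_0(Y)$ is regular if for any closed subset $Y_0$ of $Y$ and any point $y\in Y\setminus Y_0$ there is an $f\in F$ such that $f=0$ on $Y_0$ and $f(y)\neq0$. *)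

theory Defs
  imports "HOL-Analysis.Analysis" "HOL-Combinatorics.Permutations"
begin

text \<open>
  Spaces are values of type \<open>'a topology\<close>, so that the empty space is covered.  A function on
  \<open>topspace X\<close> is represented by its extension by zero to the whole type; hence equality in
  \<open>C0 X\<close> is HOL equality and \<open>C0 X\<close> is closed under the pointwise operations.
\<close>

definition C0 :: "'a topology \<Rightarrow> ('a \<Rightarrow> complex) set" where
  "C0 X = {f. continuous_map X euclidean f \<and>
              (\<forall>e>0. \<exists>K. compactin X K \<and> (\<forall>x\<in>topspace X - K. cmod (f x) < e)) \<and>
              (\<forall>x. x \<notin> topspace X \<longrightarrow> f x = 0)}"

definition C0_pos :: "'a topology \<Rightarrow> ('a \<Rightarrow> complex) set" where
  "C0_pos X = {f \<in> C0 X. \<forall>x\<in>topspace X. f x \<in> \<real>\<^sub>\<ge>\<^sub>0}"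

text \<open>Inserting 0 only matters for the empty space, where \<open>Sup {}\<close> is unspecified.\<close>

definition sup_norm :: "'a topology \<Rightarrow> ('a \<Rightarrow> complex) \<Rightarrow> real" where
  "sup_norm X f = Sup (insert 0 ((\<lambda>x. cmod (f x)) ` topspace X))"

text \<open>
  For spaces of functions \<open>E\<close> and \<open>F\<close>, an \<open>n\<close>-tuple in \<open>E\<close> is an element of
  \<open>{..<n} \<rightarrow>\<^sub>E E\<close>.  Linearity is over the complex numbers; continuity is not required.
\<close>

definition multilinear_op ::
  "nat \<Rightarrow> ('a \<Rightarrow> complex) set \<Rightarrow> ('b \<Rightarrow> complex) set \<Rightarrow>
   ((nat \<Rightarrow> 'a \<Rightarrow> complex) \<Rightarrow> 'b \<Rightarrow> complex) \<Rightarrow> bool" where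
  "multilinear_op n E F L \<longleftrightarrow>
     (\<forall>u \<in> {..<n} \<rightarrow>\<^sub>E E. L u \<in> F) \<and>
     (\<forall>u \<in> {..<n} \<rightarrow>\<^sub>E E. \<forall>i<n. \<forall>f\<in>E. \<forall>g\<in>E.
        L (u(i := (\<lambda>x. f x + g x))) = (\<lambda>y. L (u(i := f)) y + L (u(i := g)) y)) \<and>
     (\<forall>u \<in> {..<n} \<rightarrow>\<^sub>E E. \<forall>i<n. \<forall>f\<in>E. \<forall>c.
        L (u(i := (\<lambda>x. c * f x))) = (\<lambda>y. c * L (u(i := f)) y))"

definition symmetric_op ::
  "nat \<Rightarrow> ('a \<Rightarrow> complex) set \<Rightarrow> ((nat \<Rightarrow> 'a \<Rightarrow> complex) \<Rightarrow> 'b \<Rightarrow> complex) \<Rightarrow> bool" where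
  "symmetric_op n E L \<longleftrightarrow>
     (\<forall>u \<in> {..<n} \<rightarrow>\<^sub>E E. \<forall>p. p permutes {..<n} \<longrightarrow> L (u \<circ> p) = L u)"

definition homogeneous_polynomial ::
  "nat \<Rightarrow> ('a \<Rightarrow> complex) set \<Rightarrow> ('b \<Rightarrow> complex) set \<Rightarrow>
   (('a \<Rightarrow> complex) \<Rightarrow> 'b \<Rightarrow> complex) \<Rightarrow> bool" where
  "homogeneous_polynomial n E F P \<longleftrightarrow>
     (\<exists>L. multilinear_op n E F L \<and> symmetric_op n E L \<and>
          (\<forall>f\<in>E. P f = L (\<lambda>i\<in>{..<n}. f)))"

definition orthogonally_additive ::
  "'a topology \<Rightarrow> (('a \<Rightarrow> complex) \<Rightarrow> 'b \<Rightarrow> complex) \<Rightarrow> bool" where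
  "orthogonally_additive X P \<longleftrightarrow>
     (\<forall>f\<in>C0 X. \<forall>g\<in>C0 X. (\<forall>x\<in>topspace X. f x * g x = 0) \<longrightarrow>
        P (\<lambda>x. f x + g x) = (\<lambda>y. P f y + P g y))"

definition regular_subset :: "'b topology \<Rightarrow> ('b \<Rightarrow> complex) set \<Rightarrow> bool" where
  "regular_subset Y F \<longleftrightarrow>
     F \<subseteq> C0 Y \<and>
     (\<forall>Y0 y. closedin Y Y0 \<longrightarrow> y \<in> topspace Y - Y0 \<longrightarrow>
        (\<exists>f\<in>F. (\<forall>z\<in>Y0. f z = 0) \<and> f y \<noteq> 0))"

end

theory Submission
  imports Defs
begin

text \<open>
  Let \<open>L\<close> be the symmetric \<open>n\<close>-linear map behind \<open>P\<close>. By polarization, orthogonal additivity says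
  that \<open>L\<close> vanishes when its arguments split into two mutually orthogonal groups. Cutting the
  remaining arguments along level sets and using boundedness, \<open>L\<close> vanishes as soon as two of its
  arguments are orthogonal. A bounded bilinear form with this property satisfies
  \<open>B (g u) v = B u (g v)\<close>, so \<open>L\<close> depends only on the product of its arguments. Therefore
  \<open>P f = T (f\<^sup>n)\<close> with \<open>T\<close> linear and isometric on nonnegative functions.

  Holsztynski's argument applies to \<open>T\<close>: for each \<open>x\<close>, compactness gives a point \<open>y\<close> where
  \<open>\<bar>T F y\<bar> = 1\<close> for all nonnegative \<open>F\<close> with \<open>F x = 1 = \<parallel>F\<parallel>\<close>, and then \<open>T F y = u * F x\<close> for all \<open>F\<close>
  with a unimodular \<open>u\<close>. Regularity of the range makes the set of such \<open>y\<close> dense; it is also closed,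
  so every \<open>y\<close> is of this kind, and regularity once more turns \<open>y \<mapsto> x\<close> into a homeomorphism.
\<close>

text \<open>Two obstacles shape the proof. The norm condition controls only diagonal values on
  nonnegative functions, and no continuity of \<open>L\<close> is given. Bounds therefore come from
  polarization in its subset-sum version: sums of nonnegative arguments stay in the positive cone,
  and signs occur only outside the form. Moreover \<open>C0 X\<close> has no unit unless
  \<open>X\<close> is compact, so \<open>T F\<close> cannot be read off from the tuple (F, 1, ...,
  1); the constant 1 is replaced by an auxiliary function \<open>e\<close> for which
  \<open>F / e ^ (n - 1)\<close> still lies in \<open>C0 X\<close>. The identity for
  \<open>B\<close> comes from a scaling argument: after m * g is cut into m unit layers, only cross
  terms between nearby layers survive. Their sum is bounded independently of m, whereas the defect
  of the identity is multiplied by m, so it is 0. The set of good points \<open>y\<close> is closed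
  because the equations \<bar>T F y\<bar> = \<bar>F x\<bar> pass to limits without any control of
  the unimodular factor, and by linearity they already determine \<open>T F y\<close> up to that
  factor.\<close>

subsection \<open>Functions vanishing at infinity\<close>

lemma C0_outside: "f \<in> C0 X \<Longrightarrow> x \<notin> topspace X \<Longrightarrow> f x = 0"
  by (simp add: C0_def)

lemma C0_tendsto: "f \<in> C0 X \<Longrightarrow> x \<in> topspace X \<Longrightarrow> (f \<longlongrightarrow> f x) (atin X x)"
  by (simp add: C0_def continuous_map_atin)

lemma C0_compactin:
  assumes "f \<in> C0 X" "e > 0"
  shows "compactin X {x \<in> topspace X. e \<le> cmod (f x)}"
proof -
  have "\<exists>K. compactin X K \<and> (\<forall>x\<in>topspace X - K. cmod (f x) < e)"
    and cont: "continuous_map X euclidean f"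
    using assms by (auto simp: C0_def)
  then obtain K where K: "compactin X K" "\<forall>x\<in>topspace X - K. cmod (f x) < e"
    by blast
  have "continuous_map X euclideanreal (\<lambda>x. cmod (f x))"
    using cont by (intro continuous_map_norm)
  then have "closedin X {x \<in> topspace X. cmod (f x) \<in> {e..}}"
    by (rule closedin_continuous_map_preimage) auto
  then show ?thesis
    using K by (intro closed_compactin[OF K(1)]) (force simp: not_less)+
qed

text \<open>Decay at infinity and the value 0 off the space are inherited from \<open>h\<close>.
  Asking only that small \<open>h\<close> forces small \<open>f\<close>, rather than a linear bound,
  is what admits roots of \<open>h\<close>.\<close>

lemma C0_I:
  assumes "\<And>x. x \<in> topspace X \<Longrightarrow> (f \<longlongrightarrow> f x) (atin X x)" and "h \<in> C0 X"
    and small: "\<And>e. e > 0 \<Longrightarrow> \<exists>d>0. \<forall>x. cmod (h x) < d \<longrightarrow> cmod (f x) < e"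
  shows "f \<in> C0 X"
proof -
  have "\<exists>K. compactin X K \<and> (\<forall>x\<in>topspace X - K. cmod (f x) < e)" if e: "e > 0" for e
  proof -
    obtain d where d: "d > 0" "\<And>x. cmod (h x) < d \<Longrightarrow> cmod (f x) < e"
      using small[OF e] by blast
    show ?thesis
      using C0_compactin[OF \<open>h \<in> C0 X\<close> d(1)] d(2) by (metis (lifting) DiffE linorder_not_less mem_Collect_eq)
  qed
  moreover have "f x = 0" if "x \<notin> topspace X" for x
  proof (rule ccontr)
    assume "f x \<noteq> 0"
    then obtain d where "d > 0" "\<And>x'. cmod (h x') < d \<Longrightarrow> cmod (f x') < cmod (f x)"
      using small[of "cmod (f x)"] by auto
    then show False
      using C0_outside[OF \<open>h \<in> C0 X\<close> that] by (metis less_irrefl norm_zero)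
  qed
  ultimately show ?thesis
    using assms(1) by (simp add: C0_def continuous_map_atin)
qed

lemma C0_dominated:
  assumes "\<And>x. x \<in> topspace X \<Longrightarrow> (f \<longlongrightarrow> f x) (atin X x)" "h \<in> C0 X"
    and le: "\<And>x. cmod (f x) \<le> c * cmod (h x)"
  shows "f \<in> C0 X"
proof (rule C0_I[OF assms(1,2)])
  fix e :: real assume "e > 0"
  have "cmod (f x) < e" if "cmod (h x) < e / (\<bar>c\<bar> + 1)" for x
  proof -
    have "cmod (f x) \<le> (\<bar>c\<bar> + 1) * cmod (h x)"
      by (rule order_trans[OF le]) (intro mult_right_mono, auto)
    also have "\<dots> < e"
      using that by (simp add: field_simps)
    finally show ?thesis .
  qed
  then show "\<exists>d>0. \<forall>x. cmod (h x) < d \<longrightarrow> cmod (f x) < e"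
    using \<open>e > 0\<close> by (intro exI[of _ "e / (\<bar>c\<bar> + 1)"]) auto
qed

lemma C0_bounded:
  assumes "f \<in> C0 X"
  obtains b where "b > 0" "\<And>x. cmod (f x) \<le> b"
proof -
  have "continuous_map X euclideanreal (\<lambda>x. cmod (f x))"
    using assms by (intro continuous_map_norm) (auto simp: C0_def)
  then have "compactin euclideanreal ((\<lambda>x. cmod (f x)) ` {x \<in> topspace X. 1 \<le> cmod (f x)})"
    using C0_compactin[OF assms, of 1] by (intro image_compactin) auto
  then have "bounded ((\<lambda>x. cmod (f x)) ` {x \<in> topspace X. 1 \<le> cmod (f x)})"
    by (simp add: compact_imp_bounded)
  then obtain b where b: "\<And>x. x \<in> topspace X \<Longrightarrow> 1 \<le> cmod (f x) \<Longrightarrow> cmod (f x) \<le> b"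
    unfolding bounded_iff by fastforce
  have "cmod (f x) \<le> max b 1" for x
    using b[of x] C0_outside[OF assms, of x] by (cases "x \<in> topspace X") (auto simp: le_max_iff_disj)
  then show ?thesis
    using that[of "max b 1"] by auto
qed

lemma C0_zero [simp]: "(\<lambda>x. 0) \<in> C0 X"
  by (auto simp: C0_def)

lemma C0_add:
  assumes "f \<in> C0 X" "g \<in> C0 X"
  shows "(\<lambda>x. f x + g x) \<in> C0 X"
proof -
  have "\<exists>K. compactin X K \<and> (\<forall>x\<in>topspace X - K. cmod (f x + g x) < e)" if "e > 0" for e
  proof (intro exI conjI ballI)
    let ?K = "{x \<in> topspace X. e/2 \<le> cmod (f x)} \<union> {x \<in> topspace X. e/2 \<le> cmod (g x)}"
    show "compactin X ?K"
      using assms \<open>e > 0\<close> by (intro compactin_Un C0_compactin) auto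
    show "cmod (f x + g x) < e" if "x \<in> topspace X - ?K" for x
      using that norm_triangle_ineq[of "f x" "g x"] by auto
  qed
  moreover have "continuous_map X euclidean (\<lambda>x. f x + g x)"
    using assms by (simp add: continuous_map_atin) (blast intro: tendsto_add C0_tendsto)
  ultimately show ?thesis
    using assms by (auto simp: C0_def)
qed

lemma C0_times_bounded:
  assumes "f \<in> C0 X" "continuous_map X euclidean r" "\<And>x. cmod (r x) \<le> c"
  shows "(\<lambda>x. r x * f x) \<in> C0 X"
proof (rule C0_dominated[OF _ assms(1)])
  show "((\<lambda>x. r x * f x) \<longlongrightarrow> r x * f x) (atin X x)" if "x \<in> topspace X" for x
    using that assms(2) by (intro tendsto_mult C0_tendsto[OF assms(1)]) (auto simp: continuous_map_atin)
  show "cmod (r x * f x) \<le> c * cmod (f x)" for x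
    using assms(3) by (simp add: norm_mult mult_right_mono)
qed

lemma C0_mult:
  assumes "f \<in> C0 X" "g \<in> C0 X"
  shows "(\<lambda>x. f x * g x) \<in> C0 X"
proof -
  obtain b where "\<And>x. cmod (f x) \<le> b"
    using C0_bounded[OF assms(1)] by blast
  then show ?thesis
    using assms by (intro C0_times_bounded[of g X f b]) (auto simp: C0_def)
qed

lemma C0_cmult: "f \<in> C0 X \<Longrightarrow> (\<lambda>x. c * f x) \<in> C0 X"
  by (rule C0_times_bounded[of _ _ _ "cmod c"]) auto

lemma C0_diff: "f \<in> C0 X \<Longrightarrow> g \<in> C0 X \<Longrightarrow> (\<lambda>x. f x - g x) \<in> C0 X"
  using C0_add[of f X "\<lambda>x. (-1) * g x"] C0_cmult[of g X "-1"] by simp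

lemma C0_sum: "(\<And>i. i \<in> I \<Longrightarrow> f i \<in> C0 X) \<Longrightarrow> (\<lambda>x. \<Sum>i\<in>I. f i x) \<in> C0 X"
  by (induction I rule: infinite_finite_induct) (auto intro!: C0_add)

lemma C0_norm: "f \<in> C0 X \<Longrightarrow> (\<lambda>x. complex_of_real (cmod (f x))) \<in> C0 X"
  by (rule C0_dominated[of _ _ f 1]) (auto intro!: tendsto_intros C0_tendsto)

lemma C0_root:
  assumes "f \<in> C0 X" "n \<ge> 1"
  shows "(\<lambda>x. complex_of_real (root n (cmod (f x)))) \<in> C0 X"
proof (rule C0_I[OF _ assms(1)])
  show "((\<lambda>x. complex_of_real (root n (cmod (f x)))) \<longlongrightarrow> complex_of_real (root n (cmod (f x)))) (atin X x)"
    if "x \<in> topspace X" for x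
    using that assms by (intro tendsto_intros C0_tendsto)
  fix e :: real assume "e > 0"
  have "cmod (complex_of_real (root n (cmod (f x)))) < e" if "cmod (f x) < e ^ n" for x
  proof -
    have "root n (cmod (f x)) < root n (e ^ n)"
      using that assms(2) by simp
    then show ?thesis
      using \<open>e > 0\<close> assms(2) by (simp add: real_root_power_cancel)
  qed
  then show "\<exists>d>0. \<forall>x. cmod (f x) < d \<longrightarrow> cmod (complex_of_real (root n (cmod (f x)))) < e"
    using \<open>e > 0\<close> by (intro exI[of _ "e ^ n"]) auto
qed

text \<open>At a zero of \<open>g\<close> the quotient is 0 by the convention for division by zero.
  The quotient is dominated by \<open>h\<close>, which vanishes there, so 0 is also its
  limit.\<close>

lemma C0_divide:
  assumes f: "\<And>x. x \<in> topspace X \<Longrightarrow> (f \<longlongrightarrow> f x) (atin X x)"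
    and g: "\<And>x. x \<in> topspace X \<Longrightarrow> (g \<longlongrightarrow> g x) (atin X x)"
    and "h \<in> C0 X"
    and le: "\<And>x. cmod (f x) \<le> cmod (g x) * cmod (h x)"
    and zero: "\<And>x. g x = 0 \<Longrightarrow> h x = 0"
  shows "(\<lambda>x. f x / g x) \<in> C0 X"
proof (rule C0_dominated[OF _ \<open>h \<in> C0 X\<close>])
  show bd: "cmod (f x / g x) \<le> 1 * cmod (h x)" for x
    using le[of x] by (cases "g x = 0") (auto simp: norm_divide field_simps)
  show "((\<lambda>x. f x / g x) \<longlongrightarrow> f x / g x) (atin X x)" if x: "x \<in> topspace X" for x
  proof (cases "g x = 0")
    case True
    have "((\<lambda>x. cmod (h x)) \<longlongrightarrow> 0) (atin X x)"
      using tendsto_norm[OF C0_tendsto[OF \<open>h \<in> C0 X\<close> x]] zero[OF True] by simp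
    then have "((\<lambda>x. f x / g x) \<longlongrightarrow> 0) (atin X x)"
      by (rule Lim_null_comparison[rotated]) (use bd in simp)
    then show ?thesis
      using True by simp
  qed (use f g x in \<open>auto intro: tendsto_divide\<close>)
qed

text \<open>Complete regularity is applied to the complement of \<open>U \<inter> V\<close>, where
  \<open>V\<close> lies in a compact \<open>K\<close>, and not just to the complement of
  \<open>U\<close>: the function then vanishes off \<open>K\<close> and so belongs to
  \<open>C0 X\<close>.\<close>

lemma C0_bump:
  assumes X: "locally_compact_space X" "Hausdorff_space X" and "openin X U" "x \<in> U"
  obtains k :: "'a \<Rightarrow> real"
  where "(\<lambda>x. complex_of_real (k x)) \<in> C0 X" "k x = 1" "\<And>z. 0 \<le> k z" "\<And>z. k z \<le> 1"
    "\<And>z. z \<notin> U \<Longrightarrow> k z = 0"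
proof -
  have xX: "x \<in> topspace X"
    using assms openin_subset by blast
  obtain V K where V: "openin X V" "compactin X K" "x \<in> V" "V \<subseteq> K"
    using X(1) xX unfolding locally_compact_space_def by blast
  have "completely_regular_space X"
    using X by (intro locally_compact_regular_imp_completely_regular_space) auto
  moreover have "closedin X (topspace X - U \<inter> V)" "x \<in> topspace X - (topspace X - U \<inter> V)"
    using assms V xX by auto
  ultimately obtain f where f: "continuous_map X (top_of_set {0..1::real}) f" "f x = 0"
      "f ` (topspace X - U \<inter> V) \<subseteq> {1}"
    unfolding completely_regular_space_def by metis
  define k where "k z = (if z \<in> topspace X then 1 - f z else 0)" for z
  have f01: "f z \<in> {0..1}" if "z \<in> topspace X" for z
    using f(1) that by (auto simp: continuous_map_in_subtopology)
  have k0: "k z = 0" if "z \<notin> U \<inter> V" for z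
    using f(3) that by (auto simp: k_def)
  have "continuous_map X euclideanreal (\<lambda>z. 1 - f z)"
    using f(1) by (intro continuous_map_diff) (auto simp: continuous_map_in_subtopology)
  then have "continuous_map X euclideanreal k"
    by (rule continuous_map_eq) (simp add: k_def)
  then have "continuous_map X euclidean (\<lambda>z. complex_of_real (k z))"
    by (auto simp: continuous_map_atin intro!: tendsto_of_real)
  moreover have "\<forall>e>0. \<exists>K. compactin X K \<and> (\<forall>z\<in>topspace X - K. cmod (complex_of_real (k z)) < e)"
    using V k0 by (metis DiffE IntD2 norm_zero of_real_0 subsetD)
  ultimately have "(\<lambda>z. complex_of_real (k z)) \<in> C0 X"
    by (simp add: C0_def k_def)
  moreover have "k x = 1" "0 \<le> k z" "k z \<le> 1" for z
    using f(2) f01 xX by (auto simp: k_def)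
  ultimately show ?thesis
    using k0 that[of k] by blast
qed

text \<open>Multiplying by powers of -i rotates \<open>f\<close>, so the four summands are the
  positive parts of Re f, Im f, - Re f and - Im f in one formula.\<close>

lemma C0_nonneg_decomposition:
  assumes "f \<in> C0 X"
  obtains p :: "nat \<Rightarrow> 'a \<Rightarrow> complex"
  where "\<And>k. p k \<in> C0 X" "\<And>k x. p k x \<in> \<real>\<^sub>\<ge>\<^sub>0" "\<And>k x. cmod (p k x) \<le> cmod (f x)"
    "f = (\<lambda>x. \<Sum>k<4. \<i> ^ k * p k x)"
proof
  let ?p = "\<lambda>k x. complex_of_real (max 0 (Re ((-\<i>) ^ k * f x)))"
  show le: "cmod (?p k x) \<le> cmod (f x)" for k x
    using complex_Re_le_cmod[of "(-\<i>) ^ k * f x"] by (simp add: norm_mult norm_power)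
  show "?p k \<in> C0 X" for k
    using le by (intro C0_dominated[OF _ assms, of _ 1]) (auto intro!: tendsto_intros C0_tendsto[OF assms])
  show "?p k x \<in> \<real>\<^sub>\<ge>\<^sub>0" for k x
    by (simp add: nonneg_Reals_of_real_iff)
  show "f = (\<lambda>x. \<Sum>k<4. \<i> ^ k * ?p k x)"
    by (rule ext, rule complex_eqI) (simp_all add: eval_nat_numeral max_def)
qed

subsection \<open>Polarization\<close>

text \<open>The terms of \<open>S\<close> and \<open>insert j S\<close> have opposite signs and
  cancel in pairs.\<close>

lemma alternating_sum_Pow_eq_0:
  fixes f :: "'c set \<Rightarrow> 'd::comm_ring_1"
  assumes "finite A" "j \<in> A" "\<And>S. S \<subseteq> A - {j} \<Longrightarrow> f (insert j S) = f S"
  shows "(\<Sum>S\<in>Pow A. (-1) ^ card S * f S) = 0"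
proof -
  define B where "B = A - {j}"
  have A: "A = insert j B" and B: "finite B" "j \<notin> B"
    using assms by (auto simp: B_def)
  have "(\<Sum>S\<in>insert j ` Pow B. (-1) ^ card S * f S) = (\<Sum>S\<in>Pow B. (-1) ^ card (insert j S) * f (insert j S))"
    using B by (intro sum.reindex[unfolded o_def]) (auto simp: inj_on_def)
  also have "\<dots> = (\<Sum>S\<in>Pow B. - ((-1) ^ card S * f S))"
  proof (rule sum.cong[OF refl])
    fix S assume "S \<in> Pow B"
    then have "finite S" "j \<notin> S" "S \<subseteq> A - {j}"
      using B finite_subset by (auto simp: B_def)
    then show "(-1) ^ card (insert j S) * f (insert j S) = - ((-1) ^ card S * f S)"
      using assms(3) by simp
  qed
  finally show ?thesis
    unfolding A Pow_insert using B by (subst sum.union_disjoint) (auto simp: sum_negf)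
qed

text \<open>The model is the scalar form that evaluates \<open>L\<close> at one fixed point of
  \<open>Y\<close>. The assumption \<open>cong\<close> takes the place of extensionality: tuples are
  arbitrary functions on the naturals of which only the first \<open>n\<close> entries
  count.\<close>

locale C0_form =
  fixes X :: "'a topology" and n :: nat and M :: "(nat \<Rightarrow> 'a \<Rightarrow> complex) \<Rightarrow> complex"
  assumes cong: "(\<And>i. i < n \<Longrightarrow> u i = v i) \<Longrightarrow> M u = M v"
    and add: "(\<And>i. i < n \<Longrightarrow> u i \<in> C0 X) \<Longrightarrow> j < n \<Longrightarrow> f \<in> C0 X \<Longrightarrow> g \<in> C0 X \<Longrightarrow>
      M (u(j := \<lambda>x. f x + g x)) = M (u(j := f)) + M (u(j := g))"
    and scale: "(\<And>i. i < n \<Longrightarrow> u i \<in> C0 X) \<Longrightarrow> j < n \<Longrightarrow> f \<in> C0 X \<Longrightarrow>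
      M (u(j := \<lambda>x. c * f x)) = c * M (u(j := f))"
    and sym: "(\<And>i. i < n \<Longrightarrow> u i \<in> C0 X) \<Longrightarrow> p permutes {..<n} \<Longrightarrow> M (u \<circ> p) = M u"
begin

lemma slot_zero:
  assumes "\<And>i. i < n \<Longrightarrow> u i \<in> C0 X" "j < n"
  shows "M (u(j := \<lambda>x. 0)) = 0"
  using scale[OF assms C0_zero, where c = 0] by simp

lemma slot_sum:
  assumes "\<And>i. i < n \<Longrightarrow> u i \<in> C0 X" "j < n" "\<And>s. s \<in> S \<Longrightarrow> v s \<in> C0 X"
  shows "M (u(j := \<lambda>x. \<Sum>s\<in>S. v s x)) = (\<Sum>s\<in>S. M (u(j := v s)))"
  using assms(3)
proof (induction S rule: infinite_finite_induct)
  case (insert s S)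
  have "M (u(j := \<lambda>x. \<Sum>s\<in>insert s S. v s x)) = M (u(j := \<lambda>x. v s x + (\<Sum>s\<in>S. v s x)))"
    using insert.hyps by simp
  also have "\<dots> = M (u(j := v s)) + M (u(j := \<lambda>x. \<Sum>s\<in>S. v s x))"
    using insert.prems assms by (intro add C0_sum) auto
  also have "\<dots> = (\<Sum>s\<in>insert s S. M (u(j := v s)))"
    by (subst insert.IH) (use insert in auto)
  finally show ?case .
qed (use slot_zero[OF assms(1,2)] in auto)

lemma scale_all:
  assumes u: "\<And>i. i < n \<Longrightarrow> u i \<in> C0 X"
  shows "M (\<lambda>i x. c i * u i x) = (\<Prod>i<n. c i) * M u"
proof -
  have "M (\<lambda>i. if i \<in> J then (\<lambda>x. c i * u i x) else u i) = (\<Prod>i\<in>J. c i) * M u"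
    if "finite J" "J \<subseteq> {..<n}" for J
    using that
  proof (induction J)
    case (insert j J)
    let ?w = "\<lambda>i. if i \<in> J then (\<lambda>x. c i * u i x) else u i"
    have w: "?w i \<in> C0 X" if "i < n" for i
      using u[OF that] by (simp add: C0_cmult)
    have "M (\<lambda>i. if i \<in> insert j J then (\<lambda>x. c i * u i x) else u i) = M (?w(j := \<lambda>x. c j * u j x))"
      by (intro cong) auto
    also have "\<dots> = c j * M (?w(j := u j))"
      using scale[where u = ?w and j = j and f = "u j"] w u[of j] insert by auto
    also have "?w(j := u j) = ?w"
      using insert by auto
    finally show ?case
      using insert by simp
  qed simp
  from this[of "{..<n}"] have "M (\<lambda>i. if i \<in> {..<n} then (\<lambda>x. c i * u i x) else u i) = (\<Prod>i<n. c i) * M u"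
    by simp
  moreover have "M (\<lambda>i. if i \<in> {..<n} then (\<lambda>x. c i * u i x) else u i) = M (\<lambda>i x. c i * u i x)"
    by (intro cong) auto
  ultimately show ?thesis
    by simp
qed

text \<open>One slot is expanded per induction step. The entries \<open>w\<close> outside
  \<open>J\<close> are kept general so that the step can put a single \<open>v s\<close> into the
  new slot.\<close>

lemma expand_sums:
  assumes "finite J" "J \<subseteq> {..<n}" "\<And>s. s \<in> S \<Longrightarrow> v s \<in> C0 X" "\<And>i. i < n \<Longrightarrow> w i \<in> C0 X"
  shows "M (\<lambda>i. if i \<in> J then (\<lambda>x. \<Sum>s\<in>S. v s x) else w i) =
         (\<Sum>\<tau>\<in>J \<rightarrow>\<^sub>E S. M (\<lambda>i. if i \<in> J then v (\<tau> i) else w i))"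
  using assms(1,2,4)
proof (induction J arbitrary: w rule: finite_induct)
  case empty
  then show ?case by simp
next
  case (insert j J)
  let ?V = "\<lambda>x. \<Sum>s\<in>S. v s x"
  let ?w = "\<lambda>i. if i \<in> J then ?V else w i"
  have w: "?w i \<in> C0 X" if "i < n" for i
    using insert.prems that assms(3) by (auto intro: C0_sum)
  have j: "j < n"
    using insert by auto
  have "M (\<lambda>i. if i \<in> insert j J then ?V else w i) = M (?w(j := ?V))"
    by (intro cong) auto
  also have "\<dots> = (\<Sum>s\<in>S. M (?w(j := v s)))"
    using w j assms(3) by (intro slot_sum)
  also have "\<dots> = (\<Sum>s\<in>S. M (\<lambda>i. if i \<in> J then ?V else (w(j := v s)) i))"
    using insert.hyps by (intro sum.cong[OF refl] cong) auto
  also have "\<dots> = (\<Sum>s\<in>S. \<Sum>\<tau>\<in>J \<rightarrow>\<^sub>E S. M (\<lambda>i. if i \<in> J then v (\<tau> i) else (w(j := v s)) i))"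
    using insert.prems assms(3) by (intro sum.cong[OF refl] insert.IH) auto
  also have "\<dots> = (\<Sum>(s, \<tau>)\<in>S \<times> (J \<rightarrow>\<^sub>E S). M (\<lambda>i. if i \<in> insert j J then v ((\<tau>(j := s)) i) else w i))"
    unfolding sum.cartesian_product using insert.hyps by (intro sum.cong[OF refl]) (auto intro!: cong)
  also have "\<dots> = (\<Sum>\<tau>\<in>insert j J \<rightarrow>\<^sub>E S. M (\<lambda>i. if i \<in> insert j J then v (\<tau> i) else w i))"
    unfolding PiE_insert_eq
    by (subst sum.reindex) (auto intro!: inj_combinator[OF insert.hyps(2)] sum.cong)
  finally show ?case .
qed

text \<open>The number \<open>N\<close> of permutations of \<open>{..<n}\<close> is \<open>n!\<close>, but only \<open>N \<noteq> 0\<close> matters.\<close>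

lemma polarization:
  "\<exists>N\<ge>1::nat. \<forall>u. (\<forall>i<n. u i \<in> C0 X) \<longrightarrow>
      of_nat N * (-1) ^ n * M u = (\<Sum>S\<in>Pow {..<n}. (-1) ^ card S * M (\<lambda>i x. \<Sum>s\<in>S. u s x))"
proof -
  define T where "T = {\<tau> \<in> {..<n} \<rightarrow>\<^sub>E {..<n}. {..<n} \<subseteq> \<tau> ` {..<n}}"
  have finT: "finite T"
    unfolding T_def by (rule finite_subset[of _ "{..<n} \<rightarrow>\<^sub>E {..<n}"]) (auto intro: finite_PiE)
  have "restrict id {..<n} \<in> T"
    by (auto simp: T_def)
  then have "card T \<ge> 1"
    using finT by (simp add: Suc_le_eq card_gt_0_iff) blast
  moreover have "of_nat (card T) * (-1) ^ n * M u =
      (\<Sum>S\<in>Pow {..<n}. (-1) ^ card S * M (\<lambda>i x. \<Sum>s\<in>S. u s x))"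
    if u: "\<And>i. i < n \<Longrightarrow> u i \<in> C0 X" for u
  proof -
  \<comment> \<open>For fixed \<open>\<tau>\<close> only the sets \<open>S\<close> containing its
    image count. If the image misses some \<open>j\<close>, the terms with and without
    \<open>j\<close> cancel. If it misses nothing, only the full set remains, and
    \<open>\<tau>\<close> is a permutation, so symmetry applies.\<close>
  have inner: "(\<Sum>S\<in>Pow {..<n}. (-1) ^ card S * (if \<tau> ` {..<n} \<subseteq> S then M (\<lambda>i. u (\<tau> i)) else 0)) =
     (if \<tau> \<in> T then (-1) ^ n * M u else 0)" if \<tau>: "\<tau> \<in> {..<n} \<rightarrow>\<^sub>E {..<n}" for \<tau>
  proof (cases "\<tau> \<in> T")
    case True
    then have surj: "\<tau> ` {..<n} = {..<n}"
      by (auto simp: T_def)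
    then have "inj_on \<tau> {..<n}"
      by (intro eq_card_imp_inj_on) auto
    then have bij: "bij_betw \<tau> {..<n} {..<n}"
      using surj by (simp add: bij_betw_def)
    define p where "p i = (if i < n then \<tau> i else i)" for i
    have "bij_betw p {..<n} {..<n}"
      using bij by (rule bij_betw_cong[THEN iffD1, rotated]) (simp add: p_def)
    then have "p permutes {..<n}"
      by (rule bij_imp_permutes) (simp add: p_def)
    then have "M (u \<circ> p) = M u"
      using u by (intro sym)
    moreover have "M (u \<circ> p) = M (\<lambda>i. u (\<tau> i))"
      by (intro cong) (simp add: p_def)
    moreover have "(\<Sum>S\<in>Pow {..<n}. (-1) ^ card S * (if \<tau> ` {..<n} \<subseteq> S then M (\<lambda>i. u (\<tau> i)) else 0))
       = (\<Sum>S\<in>{{..<n}}. (-1) ^ card S * (if \<tau> ` {..<n} \<subseteq> S then M (\<lambda>i. u (\<tau> i)) else 0))"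
      using surj by (intro sum.mono_neutral_right) auto
    ultimately show ?thesis
      using True surj by simp
  next
    case False
    then obtain j where j: "j < n" "j \<notin> \<tau> ` {..<n}"
      using \<tau> by (auto simp: T_def)
    then show ?thesis
      using False by (subst alternating_sum_Pow_eq_0[of _ j]) (auto simp: subset_insert)
  qed
  have "(\<Sum>S\<in>Pow {..<n}. (-1) ^ card S * M (\<lambda>i x. \<Sum>s\<in>S. u s x))
     = (\<Sum>S\<in>Pow {..<n}. \<Sum>\<tau>\<in>{..<n} \<rightarrow>\<^sub>E {..<n}.
          (-1) ^ card S * (if \<tau> ` {..<n} \<subseteq> S then M (\<lambda>i. u (\<tau> i)) else 0))"
  proof (rule sum.cong[OF refl])
    fix S assume S: "S \<in> Pow {..<n}"
    have "M (\<lambda>i x. \<Sum>s\<in>S. u s x) = M (\<lambda>i. if i \<in> {..<n} then (\<lambda>x. \<Sum>s\<in>S. u s x) else u i)"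
      by (intro cong) simp
    also have "\<dots> = (\<Sum>\<tau>\<in>{..<n} \<rightarrow>\<^sub>E S. M (\<lambda>i. if i \<in> {..<n} then u (\<tau> i) else u i))"
      using S u by (intro expand_sums) auto
    also have "\<dots> = (\<Sum>\<tau>\<in>{..<n} \<rightarrow>\<^sub>E S. M (\<lambda>i. u (\<tau> i)))"
      by (intro sum.cong refl cong) simp
    also have "\<dots> = (\<Sum>\<tau>\<in>{..<n} \<rightarrow>\<^sub>E {..<n}. if \<tau> ` {..<n} \<subseteq> S then M (\<lambda>i. u (\<tau> i)) else 0)"
      using S by (intro sum.mono_neutral_cong_left) (auto simp: PiE_iff image_subset_iff intro: finite_PiE)
    finally show "(-1) ^ card S * M (\<lambda>i x. \<Sum>s\<in>S. u s x) = (\<Sum>\<tau>\<in>{..<n} \<rightarrow>\<^sub>E {..<n}.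
          (-1) ^ card S * (if \<tau> ` {..<n} \<subseteq> S then M (\<lambda>i. u (\<tau> i)) else 0))"
      by (simp add: sum_distrib_left)
  qed
  also have "\<dots> = (\<Sum>\<tau>\<in>{..<n} \<rightarrow>\<^sub>E {..<n}. if \<tau> \<in> T then (-1) ^ n * M u else 0)"
    by (subst sum.swap) (intro sum.cong refl inner)
  also have "\<dots> = (\<Sum>\<tau>\<in>T. (-1) ^ n * M u)"
    by (intro sum.mono_neutral_cong_right) (auto simp: T_def intro: finite_PiE)
  finally show ?thesis
    by simp
  qed
  ultimately show ?thesis
    by blast
qed

end

subsection \<open>Orthogonally additive forms\<close>

locale orthogonal_C0_form = C0_form +
  assumes n_pos: "n \<ge> 1"
    and orthogonal: "f \<in> C0 X \<Longrightarrow> g \<in> C0 X \<Longrightarrow> (\<And>x. f x * g x = 0) \<Longrightarrow>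
      M (\<lambda>i x. f x + g x) = M (\<lambda>i. f) + M (\<lambda>i. g)"
    and bounded_on_pos: "f \<in> C0 X \<Longrightarrow> (\<And>x. f x \<in> \<real>\<^sub>\<ge>\<^sub>0) \<Longrightarrow> (\<And>x. cmod (f x) \<le> 1) \<Longrightarrow>
      cmod (M (\<lambda>i. f)) \<le> 1"
begin

text \<open>For disjoint groups, orthogonal additivity splits each diagonal value \<open>Q S\<close>
  in the polarization formula into \<open>Q (S \<inter> A)\<close> and
  \<open>Q (S \<inter> B)\<close>. The first is blind to an element of \<open>B\<close>, the second
  to an element of \<open>A\<close>, so both alternating sums vanish. If the groups share a slot,
  its function squares to 0 and hence is 0.\<close>

lemma zero_if_two_groups:
  assumes u: "\<And>i. i < n \<Longrightarrow> u i \<in> C0 X"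
    and AB: "A \<union> B = {..<n}" "A \<noteq> {}" "B \<noteq> {}"
    and disj: "\<And>i j x. i \<in> A \<Longrightarrow> j \<in> B \<Longrightarrow> u i x * u j x = 0"
  shows "M u = 0"
proof (cases "A \<inter> B = {}")
  case False
  then obtain i where i: "i \<in> A" "i \<in> B"
    by blast
  then have "u i = (\<lambda>x. 0)"
    using disj[of i i] by auto
  then have "M u = M (u(i := \<lambda>x. 0))"
    by (intro cong) auto
  also have "\<dots> = 0"
    using u i AB by (intro slot_zero) auto
  finally show ?thesis .
next
  case True
  define Q where "Q S = M (\<lambda>i x. \<Sum>s\<in>S. u s x)" for S
  have split: "Q S = Q (S \<inter> A) + Q (S \<inter> B)" if S: "S \<in> Pow {..<n}" for S
  proof -
    have fin: "finite S"
      using S finite_subset by auto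
    have "(\<Sum>s\<in>S. u s x) = (\<Sum>s\<in>S \<inter> A. u s x) + (\<Sum>s\<in>S \<inter> B. u s x)" for x
      using S AB True fin by (subst sum.union_disjoint[symmetric]) (auto intro!: sum.cong)
    then have "Q S = M (\<lambda>i x. (\<Sum>s\<in>S \<inter> A. u s x) + (\<Sum>s\<in>S \<inter> B. u s x))"
      by (simp add: Q_def)
    also have "\<dots> = Q (S \<inter> A) + Q (S \<inter> B)"
      unfolding Q_def using AB u disj
      by (intro orthogonal C0_sum) (auto simp: sum_product intro!: sum.neutral)
    finally show ?thesis .
  qed
  obtain a b where ab: "a \<in> A" "b \<in> B"
    using AB by blast
  have A: "(\<Sum>S\<in>Pow {..<n}. (-1) ^ card S * Q (S \<inter> A)) = 0"
    using ab AB True by (intro alternating_sum_Pow_eq_0[of _ b]) (auto simp: Int_insert_left)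
  have B: "(\<Sum>S\<in>Pow {..<n}. (-1) ^ card S * Q (S \<inter> B)) = 0"
    using ab AB True by (intro alternating_sum_Pow_eq_0[of _ a]) (auto simp: Int_insert_left)
  obtain N :: nat where N: "N \<ge> 1" "of_nat N * (-1) ^ n * M u = (\<Sum>S\<in>Pow {..<n}. (-1) ^ card S * Q S)"
    unfolding Q_def using polarization u by blast
  have "(\<Sum>S\<in>Pow {..<n}. (-1) ^ card S * Q S) =
      (\<Sum>S\<in>Pow {..<n}. (-1) ^ card S * Q (S \<inter> A) + (-1) ^ card S * Q (S \<inter> B))"
    by (intro sum.cong refl) (simp add: split distrib_left)
  also have "\<dots> = 0"
    using A B by (simp add: sum.distrib)
  finally show ?thesis
    using N by simp
qed

text \<open>A slot outside \<open>A\<close> and \<open>B\<close> is cut in two at a level of \<open>g\<close> strictly between \<open>t\<close> and \<open>s\<close>: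
  one part joins \<open>A\<close>, the other joins \<open>B\<close>.\<close>

lemma zero_if_separated_groups:
  fixes g :: "'a \<Rightarrow> real"
  assumes "continuous_map X euclideanreal g"
    and "\<And>i. i < n \<Longrightarrow> u i \<in> C0 X"
    and "A \<subseteq> {..<n}" "B \<subseteq> {..<n}" "A \<noteq> {}" "B \<noteq> {}" "t < s"
    and "\<And>i x. i \<in> A \<Longrightarrow> g x < s \<Longrightarrow> u i x = 0"
    and "\<And>i x. i \<in> B \<Longrightarrow> t < g x \<Longrightarrow> u i x = 0"
  shows "M u = 0"
  using assms(2-)
proof (induction "card ({..<n} - A - B)" arbitrary: A B s t u)
  case 0
  then have "A \<union> B = {..<n}"
    by auto
  then show ?case
  proof (rule zero_if_two_groups[rotated])
    show "u i x * u j x = 0" if "i \<in> A" "j \<in> B" for i j x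
      using 0 that by (cases "g x < s") auto
  qed (use 0 in auto)
next
  case (Suc m)
  then obtain j where j: "j \<in> {..<n} - A - B"
    by (metis card.empty ex_in_conv nat.distinct(1))
  \<comment> \<open>The two inner levels leave a gap for each recursive call: between
    \<open>t\<close> and \<open>p\<close> when the slot joins \<open>A\<close>, between
    \<open>q\<close> and \<open>s\<close> when it joins \<open>B\<close>. The ramp \<open>w\<close>
    is 0 below \<open>p\<close> and 1 above \<open>q\<close>.\<close>
  define p where "p = t + (s - t) / 3"
  define q where "q = t + 2 * (s - t) / 3"
  have pq: "t < p" "p < q" "q < s"
    using \<open>t < s\<close> by (auto simp: p_def q_def field_simps)
  define w where "w x = complex_of_real (max 0 (min 1 ((g x - p) / (q - p))))" for x
  have w0: "w x = 0" if "g x < p" for x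
    using that pq by (simp add: w_def divide_nonpos_pos)
  have w1: "w x = 1" if "q < g x" for x
    using that pq by (simp add: w_def)
  have cw: "continuous_map X euclidean w"
    using assms(1) pq unfolding continuous_map_atin limitin_canonical_iff w_def
    by (intro ballI tendsto_intros) auto
  have uj: "u j \<in> C0 X"
    using j Suc.prems(1) by auto
  have wu: "(\<lambda>x. w x * u j x) \<in> C0 X"
    by (rule C0_times_bounded[OF uj cw, of 1]) (simp add: w_def)
  have vu: "(\<lambda>x. (1 - w x) * u j x) \<in> C0 X"
    using C0_diff[OF uj wu] by (simp add: algebra_simps)
  have "M (u(j := \<lambda>x. w x * u j x)) = 0"
  proof (rule Suc.hyps(1))
    show "m = card ({..<n} - insert j A - B)"
    proof -
      have "{..<n} - insert j A - B = ({..<n} - A - B) - {j}"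
        by auto
      then show ?thesis
        using Suc.hyps(2) j by (simp add: card_Diff_singleton)
    qed
    show "t < p" by fact
    show "(u(j := \<lambda>x. w x * u j x)) i x = 0" if "i \<in> insert j A" "g x < p" for i x
      using that w0 Suc.prems(7) pq by auto
  qed (use j Suc.prems wu in auto)
  moreover have "M (u(j := \<lambda>x. (1 - w x) * u j x)) = 0"
  proof (rule Suc.hyps(1))
    show "m = card ({..<n} - A - insert j B)"
    proof -
      have "{..<n} - A - insert j B = ({..<n} - A - B) - {j}"
        by auto
      then show ?thesis
        using Suc.hyps(2) j by (simp add: card_Diff_singleton)
    qed
    show "q < s" by fact
    show "(u(j := \<lambda>x. (1 - w x) * u j x)) i x = 0" if "i \<in> insert j B" "q < g x" for i x
      using that w1 Suc.prems(8) pq by auto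
  qed (use j Suc.prems vu in auto)
  moreover have "M u = M (u(j := \<lambda>x. w x * u j x + (1 - w x) * u j x))"
    by (intro cong) (simp add: algebra_simps)
  ultimately show ?case
    using add[where u = u and j = j, OF _ _ wu vu] Suc.prems(1) j by simp
qed

text \<open>Polarization expresses \<open>M u\<close> through 2^n diagonal values at subset sums.
  Each such sum is n times a nonnegative function bounded by 1, which accounts for the factor
  n^n.\<close>

lemma pos_bound:
  "\<exists>C>0. \<forall>u. (\<forall>i<n. u i \<in> C0 X) \<longrightarrow> (\<forall>i<n. \<forall>x. u i x \<in> \<real>\<^sub>\<ge>\<^sub>0) \<longrightarrow>
      (\<forall>i<n. \<forall>x. cmod (u i x) \<le> 1) \<longrightarrow> cmod (M u) \<le> C"
proof -
  obtain N :: nat where N: "N \<ge> 1"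
    "\<forall>u. (\<forall>i<n. u i \<in> C0 X) \<longrightarrow>
      of_nat N * (-1) ^ n * M u = (\<Sum>S\<in>Pow {..<n}. (-1) ^ card S * M (\<lambda>i x. \<Sum>s\<in>S. u s x))"
    using polarization by blast
  have "cmod (M u) \<le> 2 ^ n * real n ^ n"
    if u: "\<And>i. i < n \<Longrightarrow> u i \<in> C0 X" "\<And>i x. i < n \<Longrightarrow> u i x \<in> \<real>\<^sub>\<ge>\<^sub>0"
      "\<And>i x. i < n \<Longrightarrow> cmod (u i x) \<le> 1" for u
  proof -
    have S: "cmod (M (\<lambda>i x. \<Sum>s\<in>S. u s x)) \<le> real n ^ n" if S: "S \<in> Pow {..<n}" for S
    proof -
      define f where "f x = complex_of_real (1 / n) * (\<Sum>s\<in>S. u s x)" for x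
      have f: "f \<in> C0 X"
        unfolding f_def using u S by (intro C0_cmult C0_sum) auto
      have "M (\<lambda>i x. \<Sum>s\<in>S. u s x) = M (\<lambda>i x. of_nat n * f x)"
        using n_pos by (simp add: f_def)
      also have "\<dots> = of_nat n ^ n * M (\<lambda>i. f)"
        using scale_all[where u = "\<lambda>i. f" and c = "\<lambda>i. of_nat n"] f by simp
      finally have eq: "M (\<lambda>i x. \<Sum>s\<in>S. u s x) = of_nat n ^ n * M (\<lambda>i. f)" .
      have "cmod (M (\<lambda>i. f)) \<le> 1"
      proof (rule bounded_on_pos[OF f])
        have "(\<Sum>s\<in>S. u s x) \<in> \<real>\<^sub>\<ge>\<^sub>0" for x
          using S u(2) by (induction S rule: infinite_finite_induct) (auto intro: nonneg_Reals_add_I)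
        then show "f x \<in> \<real>\<^sub>\<ge>\<^sub>0" for x
          unfolding f_def by (intro nonneg_Reals_mult_I) auto
        have "cmod (\<Sum>s\<in>S. u s x) \<le> (\<Sum>s\<in>S. 1)" for x
          using u(3) S by (intro sum_norm_le) auto
        also have "(\<Sum>s\<in>S. 1) \<le> real n"
          using S card_mono[of "{..<n}" S] by simp
        finally show "cmod (f x) \<le> 1" for x
          using n_pos by (simp add: f_def norm_mult norm_divide field_simps)
      qed
      then show ?thesis
        unfolding eq by (simp add: norm_mult norm_power mult_left_le)
    qed
    have "cmod (M u) \<le> real N * cmod (M u)"
      using N(1) by (simp add: mult_le_cancel_right1)
    also have "\<dots> = cmod (of_nat N * (-1) ^ n * M u)"
      by (simp add: norm_mult norm_power)
    also have "of_nat N * (-1) ^ n * M u = (\<Sum>S\<in>Pow {..<n}. (-1) ^ card S * M (\<lambda>i x. \<Sum>s\<in>S. u s x))"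
      using N(2) u(1) by blast
    also have "cmod \<dots> \<le> (\<Sum>S\<in>Pow {..<n}. real n ^ n)"
      using S by (intro sum_norm_le) (simp add: norm_mult norm_power)
    also have "\<dots> = 2 ^ n * real n ^ n"
      by (simp add: card_Pow)
    finally show ?thesis .
  qed
  then show ?thesis
    using n_pos by (intro exI[of _ "2 ^ n * real n ^ n"]) auto
qed

text \<open>In the induction \<open>J\<close> holds the slots that may still be complex. Splitting
  one of them into four nonnegative parts costs a factor 4.\<close>

lemma unit_bound:
  "\<exists>C>0. \<forall>u. (\<forall>i<n. u i \<in> C0 X) \<longrightarrow> (\<forall>i<n. \<forall>x. cmod (u i x) \<le> 1) \<longrightarrow> cmod (M u) \<le> C"
proof -
  obtain C where C: "C > 0"
    "\<forall>u. (\<forall>i<n. u i \<in> C0 X) \<longrightarrow> (\<forall>i<n. \<forall>x. u i x \<in> \<real>\<^sub>\<ge>\<^sub>0) \<longrightarrow>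
      (\<forall>i<n. \<forall>x. cmod (u i x) \<le> 1) \<longrightarrow> cmod (M u) \<le> C"
    using pos_bound by blast
  have key: "cmod (M u) \<le> 4 ^ card J * C"
    if "finite J" "J \<subseteq> {..<n}" "\<And>i. i < n \<Longrightarrow> u i \<in> C0 X" "\<And>i x. i < n \<Longrightarrow> cmod (u i x) \<le> 1"
      "\<And>i x. i \<in> {..<n} - J \<Longrightarrow> u i x \<in> \<real>\<^sub>\<ge>\<^sub>0" for J u
    using that
  proof (induction J arbitrary: u rule: finite_induct)
    case empty
    then show ?case
      using C(2)[rule_format, of u] by simp
  next
    case (insert j J)
    have j: "j < n" "u j \<in> C0 X"
      using insert.prems by auto
    obtain p where p: "\<And>k. p k \<in> C0 X" "\<And>k x. p k x \<in> \<real>\<^sub>\<ge>\<^sub>0"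
        "\<And>k x. cmod (p k x) \<le> cmod (u j x)" "u j = (\<lambda>x. \<Sum>k<4. \<i> ^ k * p k x)"
      using C0_nonneg_decomposition[OF j(2)] by blast
    have "M u = M (u(j := \<lambda>x. \<Sum>k<4. \<i> ^ k * p k x))"
      unfolding p(4)[symmetric] by simp
    also have "\<dots> = (\<Sum>k<4. M (u(j := \<lambda>x. \<i> ^ k * p k x)))"
      using insert.prems(2) j p(1) by (intro slot_sum C0_cmult) auto
    also have "\<dots> = (\<Sum>k<4. \<i> ^ k * M (u(j := p k)))"
      using insert.prems(2) j p(1) by (intro sum.cong refl scale) auto
    finally have "cmod (M u) \<le> (\<Sum>k<4. cmod (M (u(j := p k))))"
      by (auto intro!: sum_norm_le simp: norm_mult norm_power)
    also have "\<dots> \<le> (\<Sum>k<(4::nat). 4 ^ card J * C)"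
    proof (intro sum_mono insert.IH)
      show "cmod ((u(j := p k)) i x) \<le> 1" if "i < n" for i x k
        using insert.prems(3)[OF that, of x] order_trans[OF p(3)[of k x] insert.prems(3)[OF j(1), of x]] by simp
      show "(u(j := p k)) i \<in> C0 X" if "i < n" for i k
        using insert.prems(2)[OF that] p(1)[of k] by simp
      show "(u(j := p k)) i x \<in> \<real>\<^sub>\<ge>\<^sub>0" if "i \<in> {..<n} - J" for i x k
        using insert.prems(4)[of i x] p(2)[of k x] that by (cases "i = j") simp_all
      show "J \<subseteq> {..<n}"
        using insert.prems(1) by simp
    qed
    finally show ?case
      using insert.hyps by simp
  qed
  have "cmod (M u) \<le> 4 ^ n * C"
    if "\<And>i. i < n \<Longrightarrow> u i \<in> C0 X" "\<And>i x. i < n \<Longrightarrow> cmod (u i x) \<le> 1" for u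
    using key[of "{..<n}" u, OF finite_lessThan subset_refl that] by simp
  then show ?thesis
    using C(1) by (intro exI[of _ "4 ^ n * C"]) simp
qed

lemma bound:
  "\<exists>C>0. \<forall>u a. (\<forall>i<n. u i \<in> C0 X) \<longrightarrow> (\<forall>i<n. a i > 0) \<longrightarrow>
      (\<forall>i<n. \<forall>x. cmod (u i x) \<le> a i) \<longrightarrow> cmod (M u) \<le> C * (\<Prod>i<n. a i)"
proof -
  obtain C where C: "C > 0"
    "\<forall>u. (\<forall>i<n. u i \<in> C0 X) \<longrightarrow> (\<forall>i<n. \<forall>x. cmod (u i x) \<le> 1) \<longrightarrow> cmod (M u) \<le> C"
    using unit_bound by blast
  have "cmod (M u) \<le> C * (\<Prod>i<n. a i)"
    if u: "\<And>i. i < n \<Longrightarrow> u i \<in> C0 X" and a: "\<And>i. i < n \<Longrightarrow> a i > 0"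
      and le: "\<And>i x. i < n \<Longrightarrow> cmod (u i x) \<le> a i" for u and a :: "nat \<Rightarrow> real"
  proof -
    define v where "v i x = of_real (1 / a i) * u i x" for i x
    have v: "v i \<in> C0 X" if "i < n" for i
      unfolding v_def using u[OF that] by (rule C0_cmult)
    have "M u = M (\<lambda>i x. of_real (a i) * v i x)"
      using a by (intro cong) (force simp: v_def)
    also have "\<dots> = (\<Prod>i<n. of_real (a i)) * M v"
      using v by (rule scale_all)
    finally have "cmod (M u) = (\<Prod>i<n. a i) * cmod (M v)"
      using a by (simp add: norm_mult prod_norm[symmetric] less_imp_le)
    also have "\<dots> \<le> (\<Prod>i<n. a i) * C"
      using a le v by (intro mult_left_mono C(2)[rule_format] prod_nonneg)
        (auto simp: v_def norm_mult norm_divide less_imp_le field_simps)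
    finally show ?thesis
      by (simp add: mult.commute)
  qed
  then show ?thesis
    using C(1) by (intro exI[of _ C]) simp
qed

lemma pair_bound:
  assumes w: "\<And>i. i < n \<Longrightarrow> w i \<in> C0 X" and ij: "i < n" "j < n" "i \<noteq> j"
  shows "\<exists>C>0. \<forall>u\<in>C0 X. \<forall>v\<in>C0 X. \<forall>a>0. \<forall>b>0. (\<forall>x. cmod (u x) \<le> a) \<longrightarrow>
      (\<forall>x. cmod (v x) \<le> b) \<longrightarrow> cmod (M (w(i := u, j := v))) \<le> C * a * b"
proof -
  obtain C where C: "C > 0"
    "\<forall>u a. (\<forall>i<n. u i \<in> C0 X) \<longrightarrow> (\<forall>i<n. a i > 0) \<longrightarrow>
      (\<forall>i<n. \<forall>x. cmod (u i x) \<le> a i) \<longrightarrow> cmod (M u) \<le> C * (\<Prod>i<n. a i)"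
    using bound by blast
  have "\<exists>c>0. \<forall>x. cmod (w k x) \<le> c" if "k < n" for k
    using C0_bounded[OF w[OF that]] by metis
  then obtain c where c: "\<And>k. k < n \<Longrightarrow> c k > 0" "\<And>k x. k < n \<Longrightarrow> cmod (w k x) \<le> c k"
    by metis
  define R where "R = (\<Prod>k\<in>{..<n} - {i, j}. c k)"
  have "R > 0"
    unfolding R_def using c(1) by (intro prod_pos) auto
  have "cmod (M (w(i := u, j := v))) \<le> (C * R) * a * b"
    if "u \<in> C0 X" "v \<in> C0 X" "0 < a" "0 < b" "\<And>x. cmod (u x) \<le> a" "\<And>x. cmod (v x) \<le> b" for u v a b
  proof -
    have "cmod (M (w(i := u, j := v))) \<le> C * (\<Prod>k<n. (c(i := a, j := b)) k)"
      using that w c by (intro C(2)[rule_format]) auto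
    also have "(\<Prod>k<n. (c(i := a, j := b)) k) = a * b * R"
    proof -
      have "(\<Prod>k<n. (c(i := a, j := b)) k) = (\<Prod>k\<in>{i, j} \<union> ({..<n} - {i, j}). (c(i := a, j := b)) k)"
        using ij by (intro prod.cong) auto
      also have "\<dots> = (\<Prod>k\<in>{i, j}. (c(i := a, j := b)) k) * (\<Prod>k\<in>{..<n} - {i, j}. (c(i := a, j := b)) k)"
        by (intro prod.union_disjoint) auto
      also have "(\<Prod>k\<in>{..<n} - {i, j}. (c(i := a, j := b)) k) = R"
        unfolding R_def by (intro prod.cong) auto
      also have "(\<Prod>k\<in>{i, j}. (c(i := a, j := b)) k) = a * b"
        using ij by simp
      finally show ?thesis .
    qed
    finally show ?thesis
      by (simp only: mult_ac)
  qed
  then show ?thesis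
    using \<open>C > 0\<close> \<open>R > 0\<close> by (intro exI[of _ "C * R"]) simp
qed

text \<open>The supports of \<open>u\<close> and \<open>v\<close> may touch, so there is no gap for
  \<open>zero_if_separated_groups\<close>. Cutting \<open>u\<close> off where its modulus is below
  \<open>e\<close> creates one, between the levels 0 and \<open>e\<close> of the modulus of
  \<open>u\<close>. The discarded part of \<open>u\<close> is at most \<open>2 * e\<close> in norm,
  and boundedness lets \<open>e\<close> tend to 0.\<close>

lemma zero_if_orthogonal_pair:
  assumes w: "\<And>i. i < n \<Longrightarrow> w i \<in> C0 X" and ij: "i < n" "j < n" "i \<noteq> j"
    and uv: "u \<in> C0 X" "v \<in> C0 X" "\<And>x. u x * v x = 0"
  shows "M (w(i := u, j := v)) = 0"
proof -
  obtain C where C: "C > 0"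
    "\<forall>u\<in>C0 X. \<forall>v\<in>C0 X. \<forall>a>0. \<forall>b>0. (\<forall>x. cmod (u x) \<le> a) \<longrightarrow>
      (\<forall>x. cmod (v x) \<le> b) \<longrightarrow> cmod (M (w(i := u, j := v))) \<le> C * a * b"
    using pair_bound[where w = w and i = i and j = j] w ij by blast
  obtain b where b: "b > 0" "\<And>x. cmod (v x) \<le> b"
    using C0_bounded[OF uv(2)] by blast
  have "cmod (M (w(i := u, j := v))) \<le> C * (2 * e) * b" if e: "e > 0" for e
  proof -
    \<comment> \<open>A ramp in the modulus of \<open>u\<close>: 0 up to \<open>e\<close>, 1 from
      \<open>2 * e\<close> on.\<close>
    define r where "r x = complex_of_real (max 0 (min 1 (cmod (u x) / e - 1)))" for x
    have cr: "continuous_map X euclidean r"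
      using uv(1) e unfolding continuous_map_atin limitin_canonical_iff r_def
      by (intro ballI tendsto_intros C0_tendsto) auto
    have r0: "r x = 0" if "cmod (u x) < e" for x
      using that e by (simp add: r_def max_def min_def field_simps)
    have r1: "r x = 1" if "2 * e < cmod (u x)" for x
      using that e by (simp add: r_def field_simps)
    have le1: "cmod (1 - r x) \<le> 1" for x
    proof -
      have "1 - r x = of_real (1 - max 0 (min 1 (cmod (u x) / e - 1)))"
        by (simp add: r_def)
      then show ?thesis
        by (simp only: norm_of_real)
    qed
    have ru: "(\<lambda>x. r x * u x) \<in> C0 X"
      by (rule C0_times_bounded[OF uv(1) cr, of 1]) (simp add: r_def)
    have ru': "(\<lambda>x. (1 - r x) * u x) \<in> C0 X"
      using C0_diff[OF uv(1) ru] by (simp add: algebra_simps)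
    have "M (w(i := \<lambda>x. r x * u x, j := v)) = 0"
    proof (rule zero_if_separated_groups[where A = "{i}" and B = "{j}" and t = 0 and s = e])
      show "continuous_map X euclideanreal (\<lambda>x. cmod (u x))"
        using uv(1) by (intro continuous_map_norm) (simp add: C0_def)
      show "(w(i := \<lambda>x. r x * u x, j := v)) k x = 0" if "k \<in> {i}" "cmod (u x) < e" for k x
        using that r0 ij by auto
      show "(w(i := \<lambda>x. r x * u x, j := v)) k x = 0" if "k \<in> {j}" "0 < cmod (u x)" for k x
        using that uv(3)[of x] by auto
    qed (use w ij uv ru e in auto)
    moreover have "M (w(i := u, j := v)) = M ((w(j := v))(i := \<lambda>x. r x * u x + (1 - r x) * u x))"
      using ij by (intro cong) (auto simp: algebra_simps)
    moreover have "\<dots> = M ((w(j := v))(i := \<lambda>x. r x * u x)) + M ((w(j := v))(i := \<lambda>x. (1 - r x) * u x))"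
      using w ij ru ru' uv(2) by (intro add) auto
    ultimately have "M (w(i := u, j := v)) = M (w(i := \<lambda>x. (1 - r x) * u x, j := v))"
      using ij by (simp add: fun_upd_twist)
    also have "cmod \<dots> \<le> C * (2 * e) * b"
    proof (rule C(2)[rule_format, OF ru' uv(2) _ b(1) _ b(2)])
      show "cmod ((1 - r x) * u x) \<le> 2 * e" for x
      proof (cases "2 * e < cmod (u x)")
        case False
        then show ?thesis
          using mult_mono[OF le1[of x], of "cmod (u x)" "2 * e"] by (simp add: norm_mult)
      qed (use r1 e in simp)
    qed (use e in simp)
    finally show ?thesis .
  qed
  from this[of "e / (2 * C * b)" for e] have "cmod (M (w(i := u, j := v))) \<le> e" if "e > 0" for e
    using that C(1) b(1) by simp
  then show ?thesis
    using field_le_epsilon[of "cmod (M (w(i := u, j := v)))" 0] by simp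
qed

end

subsection \<open>Bilinear forms vanishing on orthogonal pairs\<close>

lemma C0_times_real:
  assumes "f \<in> C0 X" "continuous_map X euclideanreal r" "\<And>x. 0 \<le> r x" "\<And>x. r x \<le> 1"
  shows "(\<lambda>x. complex_of_real (r x) * f x) \<in> C0 X"
proof (rule C0_times_bounded[OF assms(1), of _ 1])
  show "continuous_map X euclidean (\<lambda>x. complex_of_real (r x))"
    using assms(2) by (auto simp: continuous_map_atin intro!: tendsto_of_real)
qed (use assms(3,4) in simp)

text \<open>A discrete layer-cake formula: each summand is the part of \<open>t\<close> lying
  between the levels l and l + 1.\<close>

lemma sum_clamp:
  fixes t :: real
  assumes "0 \<le> t"
  shows "(\<Sum>l<m. max 0 (min 1 (t - real l))) = min t (real m)"
  using assms by (induction m) (auto simp: min_def max_def)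

locale local_bilinear_form =
  fixes X :: "'a topology" and B :: "('a \<Rightarrow> complex) \<Rightarrow> ('a \<Rightarrow> complex) \<Rightarrow> complex" and C :: real
  assumes add_left: "f \<in> C0 X \<Longrightarrow> f' \<in> C0 X \<Longrightarrow> g \<in> C0 X \<Longrightarrow> B (\<lambda>x. f x + f' x) g = B f g + B f' g"
    and add_right: "f \<in> C0 X \<Longrightarrow> g \<in> C0 X \<Longrightarrow> g' \<in> C0 X \<Longrightarrow> B f (\<lambda>x. g x + g' x) = B f g + B f g'"
    and scale_left: "f \<in> C0 X \<Longrightarrow> g \<in> C0 X \<Longrightarrow> B (\<lambda>x. c * f x) g = c * B f g"
    and scale_right: "f \<in> C0 X \<Longrightarrow> g \<in> C0 X \<Longrightarrow> B f (\<lambda>x. c * g x) = c * B f g"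
    and orthogonal: "f \<in> C0 X \<Longrightarrow> g \<in> C0 X \<Longrightarrow> (\<And>x. f x * g x = 0) \<Longrightarrow> B f g = 0"
    and bounded: "f \<in> C0 X \<Longrightarrow> g \<in> C0 X \<Longrightarrow> 0 < a \<Longrightarrow> 0 < b \<Longrightarrow> (\<And>x. cmod (f x) \<le> a) \<Longrightarrow>
      (\<And>x. cmod (g x) \<le> b) \<Longrightarrow> cmod (B f g) \<le> C * a * b"
begin

lemma flip: "local_bilinear_form X (\<lambda>f g. B g f) C"
proof
  fix f g :: "'a \<Rightarrow> complex" and a b :: real
  assume "f \<in> C0 X" "g \<in> C0 X" "0 < a" "0 < b" "\<And>x. cmod (f x) \<le> a" "\<And>x. cmod (g x) \<le> b"
  then show "cmod (B g f) \<le> C * a * b"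
    using bounded[of g f b a] by (simp add: mult_ac)
qed (auto simp: add_left add_right scale_left scale_right mult.commute intro: orthogonal)

lemma sum_left:
  "(\<And>s. s \<in> S \<Longrightarrow> v s \<in> C0 X) \<Longrightarrow> g \<in> C0 X \<Longrightarrow> B (\<lambda>x. \<Sum>s\<in>S. v s x) g = (\<Sum>s\<in>S. B (v s) g)"
proof (induction S rule: infinite_finite_induct)
  case (insert s S)
  have "B (\<lambda>x. \<Sum>s\<in>insert s S. v s x) g = B (\<lambda>x. v s x + (\<Sum>s\<in>S. v s x)) g"
    using insert.hyps by simp
  also have "\<dots> = B (v s) g + B (\<lambda>x. \<Sum>s\<in>S. v s x) g"
    using insert.prems by (intro add_left C0_sum) auto
  finally show ?case
    using insert by simp
qed (use scale_left[of "\<lambda>x. 0" g 0] in auto)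

lemma sum_right:
  assumes "\<And>s. s \<in> S \<Longrightarrow> v s \<in> C0 X" "f \<in> C0 X"
  shows "B f (\<lambda>x. \<Sum>s\<in>S. v s x) = (\<Sum>s\<in>S. B f (v s))"
  using local_bilinear_form.sum_left[OF flip assms] .

text \<open>Each summand below is \<open>B (p l u) (q l v)\<close> with \<open>p l\<close>, \<open>q l\<close> localised where \<open>h\<close> is within 2 of
  \<open>l + 1\<close>. Within a residue class of \<open>l\<close> modulo 3 distinct indices are orthogonal, so the sum over
  the class is a single value of \<open>B\<close>.\<close>

lemma defect_bound:
  fixes h :: "'a \<Rightarrow> real" and m :: nat
  assumes h: "continuous_map X euclideanreal h" and u: "u \<in> C0 X" and v: "v \<in> C0 X"
    and ab: "0 < a" "0 < b" "\<And>x. cmod (u x) \<le> a" "\<And>x. cmod (v x) \<le> b"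
  defines "c \<equiv> \<lambda>l x. max 0 (min 1 (h x - real l))"
  shows "cmod (\<Sum>l<m. B (\<lambda>x. of_real (c (Suc l) x) * u x) (\<lambda>x. of_real (1 - c (Suc l) x) * v x))
    \<le> 3 * (C * a * b)"
proof -
  define p where "p l x = c (Suc l) x - c (Suc (Suc l)) x" for l x
  define q where "q l x = c l x - c (Suc l) x" for l x
  have c01: "0 \<le> c l x" "c l x \<le> 1" and mono: "c (Suc l) x \<le> c l x" for l x
    by (auto simp: c_def)
  have p01: "0 \<le> p l x" "p l x \<le> 1" and q01: "0 \<le> q l x" "q l x \<le> 1" for l x
    using c01[of l x] c01[of "Suc l" x] c01[of "Suc (Suc l)" x] mono[of l x] mono[of "Suc l" x]
    by (auto simp: p_def q_def)
  have cc: "continuous_map X euclideanreal (c l)" for l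
    unfolding c_def by (intro continuous_intros h continuous_map_real_max continuous_map_real_min) auto
  have cp: "continuous_map X euclideanreal (p l)" and cq: "continuous_map X euclideanreal (q l)" for l
    unfolding p_def[abs_def] q_def[abs_def] by (intro continuous_map_diff cc)+
  have c1: "continuous_map X euclideanreal (\<lambda>x. 1 - c l x)" for l
    by (intro continuous_map_diff cc) auto
  have C0_1c: "(\<lambda>x. of_real (1 - c l x) * f x) \<in> C0 X" if "f \<in> C0 X" for f l
    by (rule C0_times_real[OF that c1]) (use c01 in auto)
  note C0s = C0_1c C0_times_real[OF _ cc c01] C0_times_real[OF _ cp p01] C0_times_real[OF _ cq q01]
  have supp_p: "h x > real l + 1 \<and> h x < real l + 3" if "p l x \<noteq> 0" for l x
    using that by (auto simp: p_def c_def max_def min_def split: if_splits)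
  have supp_q: "h x > real l \<and> h x < real l + 2" if "q l x \<noteq> 0" for l x
    using that by (auto simp: q_def c_def max_def min_def split: if_splits)
  \<comment> \<open>Of the two pieces of \<open>c (Suc l)\<close>, the piece
    \<open>c (Suc (Suc l))\<close> lives where \<open>h\<close> exceeds l + 2, and there
    \<open>1 - c (Suc l)\<close> is 0. Then \<open>1 - c (Suc l)\<close> is split likewise: its
    piece \<open>1 - c l\<close> is 0 wherever \<open>p l\<close> is not.\<close>
  have summand: "B (\<lambda>x. of_real (c (Suc l) x) * u x) (\<lambda>x. of_real (1 - c (Suc l) x) * v x) =
      B (\<lambda>x. of_real (p l x) * u x) (\<lambda>x. of_real (q l x) * v x)" for l
  proof -
    have "B (\<lambda>x. of_real (c (Suc l) x) * u x) (\<lambda>x. of_real (1 - c (Suc l) x) * v x) =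
      B (\<lambda>x. of_real (p l x) * u x + of_real (c (Suc (Suc l)) x) * u x) (\<lambda>x. of_real (1 - c (Suc l) x) * v x)"
      by (simp add: p_def algebra_simps)
    also have "\<dots> = B (\<lambda>x. of_real (p l x) * u x) (\<lambda>x. of_real (1 - c (Suc l) x) * v x)
       + B (\<lambda>x. of_real (c (Suc (Suc l)) x) * u x) (\<lambda>x. of_real (1 - c (Suc l) x) * v x)"
      using u v by (intro add_left C0s)
    also have "B (\<lambda>x. of_real (c (Suc (Suc l)) x) * u x) (\<lambda>x. of_real (1 - c (Suc l) x) * v x) = 0"
      using u v by (intro orthogonal C0s) (auto simp: c_def max_def min_def)
    also have "B (\<lambda>x. of_real (p l x) * u x) (\<lambda>x. of_real (1 - c (Suc l) x) * v x) =
      B (\<lambda>x. of_real (p l x) * u x) (\<lambda>x. of_real (q l x) * v x + of_real (1 - c l x) * v x)"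
      by (simp add: q_def algebra_simps)
    also have "\<dots> = B (\<lambda>x. of_real (p l x) * u x) (\<lambda>x. of_real (q l x) * v x) +
        B (\<lambda>x. of_real (p l x) * u x) (\<lambda>x. of_real (1 - c l x) * v x)"
      using u v by (intro add_right C0s)
    also have "B (\<lambda>x. of_real (p l x) * u x) (\<lambda>x. of_real (1 - c l x) * v x) = 0"
      using u v by (intro orthogonal C0s) (auto simp: p_def c_def max_def min_def)
    finally show ?thesis
      by simp
  qed
  define R where "R r = {l. l < m \<and> l mod 3 = r}" for r :: nat
  have class_bound: "cmod (\<Sum>l\<in>R r. B (\<lambda>x. of_real (p l x) * u x) (\<lambda>x. of_real (q l x) * v x)) \<le> C * a * b"
    (is "cmod ?s \<le> _") for r
  proof -
    have fin: "finite (R r)"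
      by (simp add: R_def)
    have orth: "B (\<lambda>x. of_real (p l x) * u x) (\<lambda>x. of_real (q k x) * v x) = 0"
      if "l \<in> R r" "k \<in> R r" "l \<noteq> k" for l k
    proof (rule orthogonal)
      fix x
      have "p l x = 0 \<or> q k x = 0"
      proof (rule ccontr)
        assume "\<not> ?thesis"
        \<comment> \<open>The intervals (l + 1, l + 3) and (k, k + 2) meet only if k - l is 0, 1 or
          2. Within one residue class modulo 3 this leaves \<open>k = l\<close>.\<close>
        then have "real l < real k + 1" "real k < real l + 3"
          using supp_p[of l x] supp_q[of k x] by auto
        then have "l \<le> k" "k < l + 3"
          by linarith+
        moreover from this have "3 dvd k - l"
          using that by (subst mod_eq_dvd_iff_nat[symmetric]) (auto simp: R_def)
        ultimately show False
          using \<open>l \<noteq> k\<close> by (auto dest: dvd_imp_le)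
      qed
      then show "of_real (p l x) * u x * (of_real (q k x) * v x) = 0"
        by auto
    qed (intro C0s u v)+
    \<comment> \<open>The weights are nonnegative and their sum over all l telescopes to at most 1.
      So the sum over a class still multiplies \<open>u\<close> or \<open>v\<close> by a factor in
      [0, 1], and its bound does not depend on \<open>m\<close>.\<close>
    have bd: "cmod ((\<Sum>l\<in>R r. of_real (s l x) * f x)) \<le> d"
      if s: "\<And>l. 0 \<le> s l x" "(\<Sum>l<m. s l x) \<le> 1" and f: "cmod (f x) \<le> d"
      for s :: "nat \<Rightarrow> 'a \<Rightarrow> real" and f :: "'a \<Rightarrow> complex" and x d
    proof -
      have "(\<Sum>l\<in>R r. s l x) \<le> (\<Sum>l<m. s l x)"
        using s(1) by (intro sum_mono2) (auto simp: R_def)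
      then have "\<bar>\<Sum>l\<in>R r. s l x\<bar> \<le> 1"
        using s by (simp add: sum_nonneg)
      then have "\<bar>\<Sum>l\<in>R r. s l x\<bar> * cmod (f x) \<le> 1 * d"
        using f by (intro mult_mono) auto
      moreover have "(\<Sum>l\<in>R r. of_real (s l x) * f x) = of_real (\<Sum>l\<in>R r. s l x) * f x"
        by (simp add: sum_distrib_right)
      ultimately show ?thesis
        by (simp only: norm_mult norm_of_real mult_1)
    qed
    have sum_p: "(\<Sum>l<m. p l x) \<le> 1" for x
      using sum_lessThan_telescope'[of "\<lambda>l. c (Suc l) x" m] c01(1)[of "Suc m" x] c01(2)[of "Suc 0" x]
      by (simp add: p_def)
    have sum_q: "(\<Sum>l<m. q l x) \<le> 1" for x
      using sum_lessThan_telescope'[of "\<lambda>l. c l x" m] c01(1)[of m x] c01(2)[of 0 x]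
      by (simp add: q_def)
    have "?s = (\<Sum>l\<in>R r. \<Sum>k\<in>R r. B (\<lambda>x. of_real (p l x) * u x) (\<lambda>x. of_real (q k x) * v x))"
    proof (rule sum.cong[OF refl])
      fix l assume l: "l \<in> R r"
      show "B (\<lambda>x. of_real (p l x) * u x) (\<lambda>x. of_real (q l x) * v x) =
          (\<Sum>k\<in>R r. B (\<lambda>x. of_real (p l x) * u x) (\<lambda>x. of_real (q k x) * v x))"
        using orth[OF l] fin by (subst sum.remove[OF fin l]) (auto intro!: sum.neutral)
    qed
    also have "\<dots> = (\<Sum>l\<in>R r. B (\<lambda>x. of_real (p l x) * u x) (\<lambda>x. \<Sum>k\<in>R r. of_real (q k x) * v x))"
      using u v by (intro sum.cong refl sum_right[symmetric] C0s)
    also have "\<dots> = B (\<lambda>x. \<Sum>l\<in>R r. of_real (p l x) * u x) (\<lambda>x. \<Sum>k\<in>R r. of_real (q k x) * v x)"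
      using u v by (intro sum_left[symmetric] C0s C0_sum)
    also have "cmod \<dots> \<le> C * a * b"
      using u v ab by (intro bounded C0_sum C0s bd p01 q01 sum_p sum_q)
    finally show ?thesis .
  qed
  have "(\<Sum>l<m. B (\<lambda>x. of_real (p l x) * u x) (\<lambda>x. of_real (q l x) * v x)) =
      (\<Sum>r<3. \<Sum>l\<in>R r. B (\<lambda>x. of_real (p l x) * u x) (\<lambda>x. of_real (q l x) * v x))"
    by (subst sum.group[where g = "\<lambda>l. l mod 3" and S = "{..<m}" and T = "{..<3::nat}", symmetric])
      (auto simp: R_def intro!: sum.cong)
  also have "cmod \<dots> \<le> (\<Sum>r<(3::nat). C * a * b)"
    using class_bound by (intro sum_norm_le) auto
  also have "\<dots> = 3 * (C * a * b)"
    by simp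
  finally show ?thesis
    unfolding summand .
qed

text \<open>The layers \<open>c (Suc l)\<close> add up to m * g. For one layer c the two sides
  differ by B (c u) ((1 - c) v) - B ((1 - c) u) (c v), because the common term B (c u) (c v)
  cancels. By \<open>defect_bound\<close> the m differences add up to at most
  \<open>6 * (C * a * b)\<close>, for every m.\<close>

lemma shift_real:
  assumes g: "continuous_map X euclideanreal g" "\<And>x. 0 \<le> g x" "\<And>x. g x \<le> 1"
    and u: "u \<in> C0 X" and v: "v \<in> C0 X"
  shows "B (\<lambda>x. of_real (g x) * u x) v = B u (\<lambda>x. of_real (g x) * v x)"
proof -
  obtain a where a: "a > 0" "\<And>x. cmod (u x) \<le> a"
    using C0_bounded[OF u] by blast
  obtain b where b: "b > 0" "\<And>x. cmod (v x) \<le> b"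
    using C0_bounded[OF v] by blast
  \<comment> \<open>The second family of cross terms is a defect sum of the form with its arguments
    exchanged.\<close>
  interpret flip: local_bilinear_form X "\<lambda>f g. B g f" C
    by (rule flip)
  let ?D = "B (\<lambda>x. of_real (g x) * u x) v - B u (\<lambda>x. of_real (g x) * v x)"
  have le: "real m * cmod ?D \<le> 6 * (C * a * b)" for m :: nat
  proof -
    \<comment> \<open>The shift by 1 matches the index \<open>Suc l\<close> in
      \<open>defect_bound\<close>: \<open>c (Suc l)\<close> is the l-th layer of m * g, and its
      lower neighbour \<open>c l\<close> exists even for l = 0.\<close>
    define h where "h x = real m * g x + 1" for x
    define c where "c l x = max 0 (min 1 (h x - real l))" for l x
    have ch: "continuous_map X euclideanreal h"
      unfolding h_def using g(1) by (intro continuous_intros) auto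
    have c01: "0 \<le> c l x" "c l x \<le> 1" for l x
      by (auto simp: c_def)
    have cc: "continuous_map X euclideanreal (c l)" for l
      unfolding c_def by (intro continuous_intros ch continuous_map_real_max continuous_map_real_min) auto
    have c1: "continuous_map X euclideanreal (\<lambda>x. 1 - c l x)" for l
      by (intro continuous_map_diff cc) auto
    have C0_1c: "(\<lambda>x. of_real (1 - c l x) * f x) \<in> C0 X" if "f \<in> C0 X" for f l
      by (rule C0_times_real[OF that c1]) (use c01 in auto)
    note C0s = C0_1c C0_times_real[OF _ cc c01]
    have sum_c: "(\<Sum>l<m. c (Suc l) x) = real m * g x" for x
      using sum_clamp[of "real m * g x" m] g(2,3)[of x] mult_left_le[of "g x" "real m"]
      by (simp add: c_def h_def algebra_simps min_def)
    have csum: "(\<Sum>l<m. of_real (c (Suc l) x) * z) = of_nat m * (of_real (g x) * z)" for x and z :: complex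
    proof -
      have "(\<Sum>l<m. of_real (c (Suc l) x) * z) = of_real (\<Sum>l<m. c (Suc l) x) * z"
        by (simp add: sum_distrib_right)
      then show ?thesis
        by (simp add: sum_c)
    qed
    have L: "of_nat m * B (\<lambda>x. of_real (g x) * u x) v = (\<Sum>l<m. B (\<lambda>x. of_real (c (Suc l) x) * u x) v)"
    proof -
      have "of_nat m * B (\<lambda>x. of_real (g x) * u x) v = B (\<lambda>x. of_nat m * (of_real (g x) * u x)) v"
        using u v g by (intro scale_left[symmetric] C0_times_real)
      also have "(\<lambda>x. of_nat m * (of_real (g x) * u x)) = (\<lambda>x. \<Sum>l<m. of_real (c (Suc l) x) * u x)"
        unfolding csum ..
      finally show ?thesis
        using sum_left[of "{..<m}" "\<lambda>l x. of_real (c (Suc l) x) * u x" v] u v by (simp add: C0s)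
    qed
    have R: "of_nat m * B u (\<lambda>x. of_real (g x) * v x) = (\<Sum>l<m. B u (\<lambda>x. of_real (c (Suc l) x) * v x))"
    proof -
      have "of_nat m * B u (\<lambda>x. of_real (g x) * v x) = B u (\<lambda>x. of_nat m * (of_real (g x) * v x))"
        using u v g by (intro scale_right[symmetric] C0_times_real)
      also have "(\<lambda>x. of_nat m * (of_real (g x) * v x)) = (\<lambda>x. \<Sum>l<m. of_real (c (Suc l) x) * v x)"
        unfolding csum ..
      finally show ?thesis
        using sum_right[of "{..<m}" "\<lambda>l x. of_real (c (Suc l) x) * v x" u] u v by (simp add: C0s)
    qed
    have diff: "B (\<lambda>x. of_real (c k x) * u x) v - B u (\<lambda>x. of_real (c k x) * v x) =
        B (\<lambda>x. of_real (c k x) * u x) (\<lambda>x. of_real (1 - c k x) * v x) -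
        B (\<lambda>x. of_real (1 - c k x) * u x) (\<lambda>x. of_real (c k x) * v x)" for k
    proof -
      have "B (\<lambda>x. of_real (c k x) * u x) v =
          B (\<lambda>x. of_real (c k x) * u x) (\<lambda>x. of_real (c k x) * v x + of_real (1 - c k x) * v x)"
        by (simp add: algebra_simps)
      also have "\<dots> = B (\<lambda>x. of_real (c k x) * u x) (\<lambda>x. of_real (c k x) * v x) +
          B (\<lambda>x. of_real (c k x) * u x) (\<lambda>x. of_real (1 - c k x) * v x)"
        using u v by (intro add_right C0s)
      finally have 1: "B (\<lambda>x. of_real (c k x) * u x) v = \<dots>" .
      have "B u (\<lambda>x. of_real (c k x) * v x) =
          B (\<lambda>x. of_real (c k x) * u x + of_real (1 - c k x) * u x) (\<lambda>x. of_real (c k x) * v x)"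
        by (simp add: algebra_simps)
      also have "\<dots> = B (\<lambda>x. of_real (c k x) * u x) (\<lambda>x. of_real (c k x) * v x) +
          B (\<lambda>x. of_real (1 - c k x) * u x) (\<lambda>x. of_real (c k x) * v x)"
        using u v by (intro add_left C0s)
      finally show ?thesis
        unfolding 1 by simp
    qed
    have "of_nat m * ?D =
        (\<Sum>l<m. B (\<lambda>x. of_real (c (Suc l) x) * u x) (\<lambda>x. of_real (1 - c (Suc l) x) * v x)) -
        (\<Sum>l<m. B (\<lambda>x. of_real (1 - c (Suc l) x) * u x) (\<lambda>x. of_real (c (Suc l) x) * v x))"
      unfolding right_diff_distrib L R sum_subtractf[symmetric] diff ..
    also have "cmod \<dots> \<le> 3 * (C * a * b) + 3 * (C * b * a)"
      unfolding c_def using ch u v a b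
      by (intro order_trans[OF norm_triangle_ineq4] add_mono defect_bound flip.defect_bound)
    finally show ?thesis
      by (simp add: norm_mult mult_ac)
  qed
  have "cmod ?D = 0"
  proof (rule ccontr)
    assume "cmod ?D \<noteq> 0"
    then have "0 < cmod ?D"
      by simp
    from reals_Archimedean3[OF this, rule_format, of "6 * (C * a * b)"]
    obtain m :: nat where "6 * (C * a * b) < real m * cmod ?D" ..
    then show False
      using le[of m] by linarith
  qed
  then show ?thesis
    by simp
qed

lemma shift:
  assumes g: "g \<in> C0 X" and u: "u \<in> C0 X" and v: "v \<in> C0 X"
  shows "B (\<lambda>x. g x * u x) v = B u (\<lambda>x. g x * v x)"
proof -
  obtain b where b: "b > 0" "\<And>x. cmod (g x) \<le> b"
    using C0_bounded[OF g] by blast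
  obtain p :: "nat \<Rightarrow> 'a \<Rightarrow> complex" where p: "\<And>k. p k \<in> C0 X" "\<And>k x. p k x \<in> \<real>\<^sub>\<ge>\<^sub>0"
      "\<And>k x. cmod (p k x) \<le> cmod (g x)" "g = (\<lambda>x. \<Sum>k<4. \<i> ^ k * p k x)"
    using C0_nonneg_decomposition[OF g] by blast
  define r where "r k x = Re (p k x) / b" for k x
  have pr: "p k x = of_real b * of_real (r k x)" for k x
    using p(2)[of k x] b(1) by (simp add: r_def complex_nonneg_Reals_iff complex_eq_iff)
  have r01: "0 \<le> r k x" for k x
    using p(2)[of k x] b(1) by (simp add: r_def complex_nonneg_Reals_iff)
  have r1: "r k x \<le> 1" for k x
    using p(3)[of k x] b(1) b(2)[of x] complex_Re_le_cmod[of "p k x"] by (simp add: r_def)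
  have cr: "continuous_map X euclideanreal (r k)" for k
    unfolding continuous_map_atin limitin_canonical_iff r_def using b(1)
    by (intro ballI tendsto_intros C0_tendsto p) auto
  have gu: "(\<lambda>x. g x * f x) = (\<lambda>x. \<Sum>k<4. (\<i> ^ k * of_real b) * (of_real (r k x) * f x))" for f
    by (subst p(4)) (simp add: pr sum_distrib_right mult.assoc)
  note C0r = C0_times_real[OF _ cr r01 r1]
  have "B (\<lambda>x. g x * u x) v = (\<Sum>k<4. B (\<lambda>x. (\<i> ^ k * of_real b) * (of_real (r k x) * u x)) v)"
    unfolding gu using u v by (intro sum_left C0_cmult C0r)
  also have "\<dots> = (\<Sum>k<4. (\<i> ^ k * of_real b) * B (\<lambda>x. of_real (r k x) * u x) v)"
    using u v by (intro sum.cong refl scale_left C0r)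
  also have "\<dots> = (\<Sum>k<4. (\<i> ^ k * of_real b) * B u (\<lambda>x. of_real (r k x) * v x))"
    by (simp only: shift_real[OF cr r01 r1 u v])
  also have "\<dots> = (\<Sum>k<4. B u (\<lambda>x. (\<i> ^ k * of_real b) * (of_real (r k x) * v x)))"
    using u v by (intro sum.cong refl scale_right[symmetric] C0r)
  also have "\<dots> = B u (\<lambda>x. g x * v x)"
    unfolding gu using u v by (intro sum_right[symmetric] C0_cmult C0r)
  finally show ?thesis .
qed

end

subsection \<open>Linearization\<close>

lemma C0_power: "f \<in> C0 X \<Longrightarrow> (\<lambda>x. f x ^ Suc k) \<in> C0 X"
  by (induction k) (auto intro: C0_mult)

lemma C0_times_prod:
  assumes "finite J" "f \<in> C0 X" "\<And>j. j \<in> J \<Longrightarrow> g j \<in> C0 X"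
  shows "(\<lambda>x. f x * (\<Prod>j\<in>J. g j x)) \<in> C0 X"
  using assms(1,3)
proof (induction J rule: finite_induct)
  case (insert j J)
  then have "(\<lambda>x. g j x * (f x * (\<Prod>j\<in>J. g j x))) \<in> C0 X"
    by (intro C0_mult[of "g j"]) auto
  then show ?case
    using insert.hyps by (simp add: mult_ac)
qed (use assms(2) in simp)

text \<open>A substitute for the tuple (F, 1, ..., 1): the other slots contain \<open>e\<close>, and
  slot 0 compensates for it, so that the product is again \<open>F\<close> as long as
  \<open>F\<close> vanishes wherever \<open>e\<close> does.\<close>

definition slot_tuple :: "nat \<Rightarrow> ('a \<Rightarrow> complex) \<Rightarrow> ('a \<Rightarrow> complex) \<Rightarrow> nat \<Rightarrow> 'a \<Rightarrow> complex" where
  "slot_tuple n e F i = (if i = 0 then (\<lambda>x. F x / e x ^ (n - 1)) else e)"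

text \<open>The exponent \<open>2 * n\<close> instead of \<open>n\<close> makes the quotient continuous at the zeros of \<open>e\<close>, where it
  has the value 0.\<close>

lemma slot_tuple_C0:
  assumes "e \<in> C0 X" "F \<in> C0 X" and le: "\<And>x. cmod (F x) \<le> cmod (e x) ^ (2 * n)" and n: "n \<ge> 1"
  shows "slot_tuple n e F i \<in> C0 X"
proof -
  have "(\<lambda>x. F x / e x ^ (n - 1)) \<in> C0 X"
  proof (rule C0_divide)
    show "(\<lambda>x. e x ^ Suc n) \<in> C0 X"
      by (rule C0_power) fact
    have "2 * n = (n - 1) + Suc n"
      using n by simp
    then show "cmod (F x) \<le> cmod (e x ^ (n - 1)) * cmod (e x ^ Suc n)" for x
      using le[of x] by (simp only: norm_power power_add)
    show "e x ^ Suc n = 0" if "e x ^ (n - 1) = 0" for x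
      using that by (simp split: if_splits)
  qed (use assms in \<open>auto intro!: tendsto_intros C0_tendsto\<close>)
  then show ?thesis
    using assms by (simp add: slot_tuple_def)
qed

lemma prod_slot_tuple:
  assumes le: "cmod (F x) \<le> cmod (e x) ^ (2 * n)" and n: "n \<ge> 1"
  shows "(\<Prod>i<n. slot_tuple n e F i x) = F x"
proof -
  have "{..<n} = insert 0 {1..<n}"
    using n by auto
  then have "(\<Prod>i<n. slot_tuple n e F i x) = F x / e x ^ (n - 1) * e x ^ (n - 1)"
    by (simp add: slot_tuple_def)
  \<comment> \<open>Where \<open>e\<close> vanishes, the bound forces \<open>F x = 0\<close>, so the
    value 0 of the quotient is the right one.\<close>
  also have "\<dots> = F x"
    using le n by (cases "e x = 0") (auto simp: power_0_left)
  finally show ?thesis .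
qed

lemma root_norm_C0: "F \<in> C0 X \<Longrightarrow> n \<ge> 1 \<Longrightarrow> (\<lambda>x. complex_of_real (root (2 * n) (cmod (F x)))) \<in> C0 X"
  by (intro C0_root) auto

lemma root_norm_power:
  "n \<ge> 1 \<Longrightarrow> cmod (complex_of_real (root (2 * n) (cmod z))) ^ (2 * n) = cmod z"
  by (simp add: real_root_pow_pos2)

context orthogonal_C0_form
begin

lemma shift_slots:
  assumes w: "\<And>i. i < n \<Longrightarrow> w i \<in> C0 X" and ij: "i < n" "j < n" "i \<noteq> j"
    and guv: "g \<in> C0 X" "u \<in> C0 X" "v \<in> C0 X"
  shows "M (w(i := \<lambda>x. g x * u x, j := v)) = M (w(i := u, j := \<lambda>x. g x * v x))"
proof -
  obtain C where C: "C > 0"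
    "\<forall>u\<in>C0 X. \<forall>v\<in>C0 X. \<forall>a>0. \<forall>b>0. (\<forall>x. cmod (u x) \<le> a) \<longrightarrow>
      (\<forall>x. cmod (v x) \<le> b) \<longrightarrow> cmod (M (w(i := u, j := v))) \<le> C * a * b"
    using pair_bound[where w = w and i = i and j = j] w ij by blast
  have sw: "w(i := f, j := g) = w(j := g, i := f)" for f g
    using ij by (auto simp: fun_upd_twist)
  interpret local_bilinear_form X "\<lambda>f g. M (w(i := f, j := g))" C
  proof
    show "M (w(i := \<lambda>x. f x + f' x, j := g)) = M (w(i := f, j := g)) + M (w(i := f', j := g))"
      if "f \<in> C0 X" "f' \<in> C0 X" "g \<in> C0 X" for f f' g
      unfolding sw using w ij that by (intro add) auto
    show "M (w(i := f, j := \<lambda>x. g x + g' x)) = M (w(i := f, j := g)) + M (w(i := f, j := g'))"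
      if "f \<in> C0 X" "g \<in> C0 X" "g' \<in> C0 X" for f g g'
      using w ij that by (intro add) auto
    show "M (w(i := \<lambda>x. c * f x, j := g)) = c * M (w(i := f, j := g))"
      if "f \<in> C0 X" "g \<in> C0 X" for f g c
      unfolding sw using w ij that by (intro scale) auto
    show "M (w(i := f, j := \<lambda>x. c * g x)) = c * M (w(i := f, j := g))"
      if "f \<in> C0 X" "g \<in> C0 X" for f g c
      using w ij that by (intro scale) auto
    show "M (w(i := f, j := g)) = 0" if "f \<in> C0 X" "g \<in> C0 X" "\<And>x. f x * g x = 0" for f g
      using w ij that by (intro zero_if_orthogonal_pair) auto
    show "cmod (M (w(i := f, j := g))) \<le> C * a * b"
      if "f \<in> C0 X" "g \<in> C0 X" "0 < a" "0 < b" "\<And>x. cmod (f x) \<le> a" "\<And>x. cmod (g x) \<le> b" for f g a b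
      using C(2) that by blast
  qed
  show ?thesis
    using guv by (rule shift)
qed

text \<open>\<open>shift_slots\<close> carries the factors \<open>g j\<close> to slot 0 one after
  another. The spare factor \<open>e\<close> is what remains in a slot once its \<open>g j\<close>
  has left, in place of the missing unit.\<close>

lemma collect_factors:
  assumes e: "e \<in> C0 X" and g: "\<And>i. i < n \<Longrightarrow> g i \<in> C0 X"
  shows "M (\<lambda>i x. e x * g i x) = M (\<lambda>i. if i = 0 then (\<lambda>x. e x * (\<Prod>k<n. g k x)) else e)"
proof -
  \<comment> \<open>The tuple reached once the factors with indices in \<open>J\<close> have moved
    to slot 0.\<close>
  define W where "W J i = (if i = 0 then (\<lambda>x. e x * g 0 x * (\<Prod>k\<in>J. g k x))
      else if i \<in> J then e else (\<lambda>x. e x * g i x))" for J and i :: nat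
  have "M (\<lambda>i x. e x * g i x) = M (W J)" if "finite J" "J \<subseteq> {1..<n}" for J
    using that
  proof (induction J rule: finite_induct)
    case empty
    show ?case
      by (intro cong) (simp add: W_def)
  next
    case (insert j J)
    let ?u = "\<lambda>x. e x * g 0 x * (\<Prod>k\<in>J. g k x)"
    have j: "j < n" "j \<noteq> 0" and g0: "g 0 \<in> C0 X" and gJ: "\<And>k. k \<in> J \<Longrightarrow> g k \<in> C0 X"
      using insert.prems n_pos g by auto
    have u: "?u \<in> C0 X"
      using insert.hyps gJ by (intro C0_times_prod C0_mult e g0)
    have W: "W J i \<in> C0 X" if "i < n" for i
      using u e g[OF that] by (auto simp: W_def intro: C0_mult)
    have "M (W J) = M ((W J)(0 := ?u, j := \<lambda>x. g j x * e x))"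
      using j insert.hyps by (intro cong) (auto simp: W_def mult.commute)
    also have "\<dots> = M ((W J)(0 := \<lambda>x. g j x * ?u x, j := e))"
      using j n_pos W u e g by (intro shift_slots[symmetric]) auto
    also have "\<dots> = M (W (insert j J))"
      using j insert.hyps by (intro cong) (auto simp: W_def mult_ac)
    finally show ?case
      using insert by simp
  qed
  from this[of "{1..<n}"] have "M (\<lambda>i x. e x * g i x) = M (W {1..<n})"
    by simp
  also have "\<dots> = M (\<lambda>i. if i = 0 then (\<lambda>x. e x * (\<Prod>k<n. g k x)) else e)"
  proof (intro cong)
    fix i assume "i < n"
    moreover have "(\<Prod>k<n. g k x) = g 0 x * (\<Prod>k\<in>{1..<n}. g k x)" for x
    proof -
      have "{..<n} = insert 0 {1..<n}"
        using n_pos by auto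
      then show ?thesis
        by simp
    qed
    ultimately show "W {1..<n} i = (if i = 0 then (\<lambda>x. e x * (\<Prod>k<n. g k x)) else e)"
      by (auto simp: W_def mult_ac)
  qed
  finally show ?thesis .
qed

text \<open>Both tuples are factored through the same \<open>e\<close>, the square root of a
  function \<open>s\<close> that dominates all their entries. An entry w is e * (w / e) with the
  quotient bounded by \<open>e\<close>, hence in \<open>C0 X\<close>. After
  \<open>collect_factors\<close> only the product of the quotients is left, and it agrees for both
  tuples.\<close>

lemma depends_on_product:
  assumes u: "\<And>i. i < n \<Longrightarrow> u i \<in> C0 X" and v: "\<And>i. i < n \<Longrightarrow> v i \<in> C0 X"
    and eq: "\<And>x. (\<Prod>i<n. u i x) = (\<Prod>i<n. v i x)"
  shows "M u = M v"
proof -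
  define s where "s x = (\<Sum>i<n. cmod (u i x) + cmod (v i x))" for x
  define e where "e x = complex_of_real (sqrt (s x))" for x
  have s_nonneg: "0 \<le> s x" for x
    unfolding s_def by (intro sum_nonneg) auto
  have "(\<lambda>x. \<Sum>i<n. complex_of_real (cmod (u i x)) + complex_of_real (cmod (v i x))) \<in> C0 X"
    using u v by (intro C0_sum C0_add C0_norm) auto
  then have "(\<lambda>x. complex_of_real (s x)) \<in> C0 X"
    by (simp add: s_def)
  then have e: "e \<in> C0 X"
    using C0_root[of "\<lambda>x. complex_of_real (s x)" X 2] s_nonneg by (simp add: e_def[abs_def] sqrt_def)
  have ee: "cmod (e x) * cmod (e x) = s x" for x
    using s_nonneg[of x] by (simp add: e_def)
  have factor: "M w = M (\<lambda>i. if i = 0 then (\<lambda>x. e x * (\<Prod>k<n. w k x / e x)) else e)"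
    if w: "\<And>i. i < n \<Longrightarrow> w i \<in> C0 X" and le: "\<And>i x. i < n \<Longrightarrow> cmod (w i x) \<le> s x" for w
  proof -
    have q: "(\<lambda>x. w i x / e x) \<in> C0 X" if "i < n" for i
      using le[OF that] by (intro C0_divide[OF _ _ e] C0_tendsto w e that) (simp_all add: ee)
    have "w i x = e x * (w i x / e x)" if "i < n" for i x
      using le[OF that, of x] by (auto simp: e_def)
    then have "M w = M (\<lambda>i x. e x * (w i x / e x))"
      by (intro cong) auto
    also have "\<dots> = M (\<lambda>i. if i = 0 then (\<lambda>x. e x * (\<Prod>k<n. w k x / e x)) else e)"
      using e q by (rule collect_factors)
    finally show ?thesis .
  qed
  have le: "cmod (u i x) + cmod (v i x) \<le> s x" if "i < n" for i x
    unfolding s_def using that by (intro member_le_sum) auto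
  have "cmod (u i x) \<le> s x" "cmod (v i x) \<le> s x" if "i < n" for i x
    using le[OF that, of x] norm_ge_zero[of "u i x"] norm_ge_zero[of "v i x"] by linarith+
  then have "M u = M (\<lambda>i. if i = 0 then (\<lambda>x. e x * (\<Prod>k<n. u k x / e x)) else e)"
    and "M v = M (\<lambda>i. if i = 0 then (\<lambda>x. e x * (\<Prod>k<n. v k x / e x)) else e)"
    using u v by (auto intro: factor)
  moreover have "(\<Prod>k<n. u k x / e x) = (\<Prod>k<n. v k x / e x)" for x
    by (simp only: prod_dividef eq)
  ultimately show ?thesis
    by (simp cong: if_cong)
qed

text \<open>By \<open>depends_on_product\<close> every tuple with product \<open>F\<close> gives the
  same value; taking the root of the modulus of \<open>F\<close> as \<open>e\<close> is one
  canonical choice of such a tuple.\<close>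

definition linearization :: "('a \<Rightarrow> complex) \<Rightarrow> complex" where
  "linearization F = M (slot_tuple n (\<lambda>x. complex_of_real (root (2 * n) (cmod (F x)))) F)"

lemma linearization_eq:
  assumes "\<And>i. i < n \<Longrightarrow> u i \<in> C0 X" "F \<in> C0 X" "\<And>x. (\<Prod>i<n. u i x) = F x"
  shows "linearization F = M u"
  unfolding linearization_def using assms n_pos
  by (intro depends_on_product slot_tuple_C0 root_norm_C0)
     (simp_all add: prod_slot_tuple root_norm_power)

lemma linearization_power:
  assumes "f \<in> C0 X"
  shows "linearization (\<lambda>x. f x ^ n) = M (\<lambda>i. f)"
  using assms n_pos C0_power[of f X "n - 1"] by (intro linearization_eq) auto

lemma linearization_scale:
  assumes F: "F \<in> C0 X"
  shows "linearization (\<lambda>x. c * F x) = c * linearization F"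
proof -
  let ?e = "\<lambda>x. complex_of_real (root (2 * n) (cmod (F x)))"
  let ?u = "slot_tuple n ?e F"
  have u: "?u i \<in> C0 X" for i
    using F n_pos by (intro slot_tuple_C0 root_norm_C0) (simp_all add: root_norm_power)
  have "(\<Prod>i<n. (?u(0 := \<lambda>x. c * ?u 0 x)) i x) = c * F x" for x
  proof -
    have n: "{..<n} = insert 0 {1..<n}"
      using n_pos by auto
    have "(\<Prod>i\<in>{1..<n}. (?u(0 := \<lambda>x. c * ?u 0 x)) i x) = (\<Prod>i\<in>{1..<n}. ?u i x)"
      by (intro prod.cong) auto
    then show ?thesis
      using prod_slot_tuple[of F x ?e n] n_pos by (simp add: n root_norm_power mult.assoc)
  qed
  then have "linearization (\<lambda>x. c * F x) = M (?u(0 := \<lambda>x. c * ?u 0 x))"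
    using u F by (intro linearization_eq) (auto intro: C0_cmult)
  also have "\<dots> = c * M (?u(0 := ?u 0))"
    using u n_pos by (intro scale) auto
  finally show ?thesis
    by (simp add: linearization_def)
qed

text \<open>The canonical tuples of \<open>F\<close>, \<open>G\<close> and their sum use different
  functions \<open>e\<close>. Built from \<bar>F\<bar> + \<bar>G\<bar>, one \<open>e\<close> serves
  all three; the tuples then differ only in slot 0, where the form is additive.\<close>

lemma linearization_add:
  assumes F: "F \<in> C0 X" and G: "G \<in> C0 X"
  shows "linearization (\<lambda>x. F x + G x) = linearization F + linearization G"
proof -
  define H where "H x = complex_of_real (cmod (F x)) + complex_of_real (cmod (G x))" for x
  define e where "e x = complex_of_real (root (2 * n) (cmod (H x)))" for x
  have H: "H \<in> C0 X"
    unfolding H_def by (intro C0_add C0_norm F G)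
  have e: "e \<in> C0 X"
    unfolding e_def using H n_pos by (rule root_norm_C0)
  have pw: "cmod (e x) ^ (2 * n) = cmod (F x) + cmod (G x)" for x
    unfolding e_def root_norm_power[OF n_pos] H_def by (simp flip: of_real_add)
  have lin: "linearization K = M (slot_tuple n e K)" and C0K: "slot_tuple n e K i \<in> C0 X"
    if "K \<in> C0 X" "\<And>x. cmod (K x) \<le> cmod (F x) + cmod (G x)" for K i
  proof -
    have le: "cmod (K x) \<le> cmod (e x) ^ (2 * n)" for x
      using that(2) by (simp only: pw)
    show C0K: "slot_tuple n e K i \<in> C0 X" for i
      using e that(1) le n_pos by (rule slot_tuple_C0)
    show "linearization K = M (slot_tuple n e K)"
      using that(1) le n_pos by (intro linearization_eq C0K prod_slot_tuple)
  qed
  let ?u = "slot_tuple n e F"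
  have FG: "cmod (F x) \<le> cmod (F x) + cmod (G x)" "cmod (G x) \<le> cmod (F x) + cmod (G x)" for x
    by auto
  have "linearization (\<lambda>x. F x + G x) = M (slot_tuple n e (\<lambda>x. F x + G x))"
    by (intro lin C0_add F G norm_triangle_ineq)
  also have "\<dots> = M (?u(0 := \<lambda>x. ?u 0 x + slot_tuple n e G 0 x))"
    by (intro cong) (auto simp: slot_tuple_def add_divide_distrib)
  also have "\<dots> = M (?u(0 := ?u 0)) + M (?u(0 := slot_tuple n e G 0))"
    using n_pos by (intro add C0K F G FG) auto
  also have "M (?u(0 := slot_tuple n e G 0)) = M (slot_tuple n e G)"
    by (intro cong) (simp add: slot_tuple_def)
  finally show ?thesis
    using lin[OF F FG(1)] lin[OF G FG(2)] by simp
qed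

end

subsection \<open>Linear isometries on the positive cone\<close>

lemma cmod_le_sup_norm:
  assumes "g \<in> C0 Y"
  shows "cmod (g y) \<le> sup_norm Y g"
proof -
  obtain b where b: "\<And>x. cmod (g x) \<le> b"
    using C0_bounded[OF assms] by blast
  then have "bdd_above (insert 0 ((\<lambda>x. cmod (g x)) ` topspace Y))"
    by (auto intro!: bdd_aboveI[of _ b] simp: order_trans[OF norm_ge_zero b])
  moreover have "cmod (g y) \<in> insert 0 ((\<lambda>x. cmod (g x)) ` topspace Y)"
    using C0_outside[OF assms] by (cases "y \<in> topspace Y") auto
  ultimately show ?thesis
    unfolding sup_norm_def by (intro cSup_upper)
qed

lemma sup_norm_le: "0 \<le> a \<Longrightarrow> (\<And>x. x \<in> topspace X \<Longrightarrow> cmod (f x) \<le> a) \<Longrightarrow> sup_norm X f \<le> a"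
  unfolding sup_norm_def by (intro cSup_least) auto

lemma sup_norm_attained:
  assumes g: "g \<in> C0 Y" and pos: "sup_norm Y g > 0"
  obtains y where "y \<in> topspace Y" "cmod (g y) = sup_norm Y g"
proof -
  let ?s = "sup_norm Y g"
  define K where "K = {y \<in> topspace Y. ?s / 2 \<le> cmod (g y)}"
  have "K \<noteq> {}"
  proof
    assume "K = {}"
    then have "?s \<le> ?s / 2"
      using pos by (intro sup_norm_le) (auto simp: K_def not_le intro: less_imp_le)
    then show False
      using pos by simp
  qed
  moreover have "compactin Y K"
    unfolding K_def using g pos by (intro C0_compactin) auto
  moreover have "continuous_map Y euclideanreal (\<lambda>x. cmod (g x))"
    using g by (intro continuous_map_norm) (simp add: C0_def)
  ultimately have "compact ((\<lambda>x. cmod (g x)) ` K)" "(\<lambda>x. cmod (g x)) ` K \<noteq> {}"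
    using image_compactin by fastforce+
  then obtain y where y: "y \<in> K" "\<And>z. z \<in> K \<Longrightarrow> cmod (g z) \<le> cmod (g y)"
    using compact_attains_sup[of "(\<lambda>x. cmod (g x)) ` K"] by auto
  have "?s \<le> cmod (g y)"
  proof (rule sup_norm_le)
    show "cmod (g z) \<le> cmod (g y)" if "z \<in> topspace Y" for z
      using y that by (cases "z \<in> K") (auto simp: K_def)
  qed simp
  then show ?thesis
    using that[of y] y(1) cmod_le_sup_norm[OF g, of y] by (auto simp: K_def)
qed

lemma compactin_finite_intersections:
  assumes "compactin X K" "\<And>i. i \<in> I \<Longrightarrow> closedin X (C i)"
    and fin: "\<And>J. finite J \<Longrightarrow> J \<subseteq> I \<Longrightarrow> \<exists>x\<in>K. \<forall>j\<in>J. x \<in> C j"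
  shows "\<exists>x\<in>K. \<forall>i\<in>I. x \<in> C i"
proof -
  have "K \<inter> \<Inter>\<F> \<noteq> {}" if \<F>: "finite \<F>" "\<F> \<subseteq> C ` I" for \<F>
  proof -
    obtain J where "J \<subseteq> I" "finite J" "\<F> = C ` J"
      using finite_subset_image[OF \<F>] by blast
    then show ?thesis
      using fin[of J] by auto
  qed
  moreover have "\<forall>D\<in>C ` I. closedin X D"
    using assms(2) by blast
  ultimately have "K \<inter> \<Inter>(C ` I) \<noteq> {}"
    using assms(1)[unfolded compactin_fip, THEN conjunct2, THEN spec[of _ "C ` I"]] by blast
  then show ?thesis
    by auto
qed

text \<open>Parallelogram law: the squared distance is 2 + 2 - 4.\<close>

lemma eq_if_norm_sum_eq_2:
  fixes a b :: complex
  assumes "cmod a = 1" "cmod b = 1" "cmod (a + b) = 2"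
  shows "a = b"
proof -
  have "(cmod (a - b))\<^sup>2 + (cmod (a + b))\<^sup>2 = 2 * (cmod a)\<^sup>2 + 2 * (cmod b)\<^sup>2"
    unfolding cmod_power2 by (simp add: power2_eq_square algebra_simps)
  then show ?thesis
    using assms by simp
qed

text \<open>Isometry on the cone enters as a contraction bound together with the attainment of the
  value 1. Nothing is said about norms of images of general complex functions.\<close>

locale positive_isometry =
  fixes X :: "'a topology" and Y :: "'b topology" and T :: "('a \<Rightarrow> complex) \<Rightarrow> 'b \<Rightarrow> complex"
  assumes X: "locally_compact_space X" "Hausdorff_space X" and Y: "Hausdorff_space Y"
    and T_C0: "F \<in> C0 X \<Longrightarrow> T F \<in> C0 Y"
    and T_add: "F \<in> C0 X \<Longrightarrow> G \<in> C0 X \<Longrightarrow> T (\<lambda>x. F x + G x) y = T F y + T G y"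
    and T_scale: "F \<in> C0 X \<Longrightarrow> T (\<lambda>x. c * F x) y = c * T F y"
    and T_le: "F \<in> C0 X \<Longrightarrow> (\<And>x. F x \<in> \<real>\<^sub>\<ge>\<^sub>0) \<Longrightarrow> (\<And>x. cmod (F x) \<le> 1) \<Longrightarrow> cmod (T F y) \<le> 1"
    and T_attains: "F \<in> C0 X \<Longrightarrow> (\<And>x. F x \<in> \<real>\<^sub>\<ge>\<^sub>0) \<Longrightarrow> (\<And>x. cmod (F x) \<le> 1) \<Longrightarrow>
      x \<in> topspace X \<Longrightarrow> F x = 1 \<Longrightarrow> \<exists>y\<in>topspace Y. cmod (T F y) = 1"
    and T_regular: "closedin Y Z \<Longrightarrow> y \<in> topspace Y - Z \<Longrightarrow>
      \<exists>F\<in>C0 X. (\<forall>z\<in>Z. T F z = 0) \<and> T F y \<noteq> 0"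
begin

lemma T_diff:
  assumes "F \<in> C0 X" "G \<in> C0 X"
  shows "T (\<lambda>x. F x - G x) y = T F y - T G y"
  using T_add[OF assms(1) C0_cmult[OF assms(2)], of "-1" y] T_scale[OF assms(2), of "-1" y] by simp

lemma T_sum: "(\<And>i. i \<in> I \<Longrightarrow> F i \<in> C0 X) \<Longrightarrow> T (\<lambda>x. \<Sum>i\<in>I. F i x) y = (\<Sum>i\<in>I. T (F i) y)"
proof (induction I rule: infinite_finite_induct)
  case (insert i I)
  have "T (\<lambda>x. \<Sum>i\<in>insert i I. F i x) y = T (\<lambda>x. F i x + (\<Sum>i\<in>I. F i x)) y"
    using insert.hyps by simp
  also have "\<dots> = T (F i) y + T (\<lambda>x. \<Sum>i\<in>I. F i x) y"
    using insert.prems by (intro T_add C0_sum) auto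
  finally show ?case
    using insert by simp
qed (use T_scale[OF C0_zero, of 0 y] in auto)

section \<open>Peaking functions and points of evaluation\<close>

definition peak :: "'a \<Rightarrow> ('a \<Rightarrow> complex) set" where
  "peak x = {F \<in> C0 X. (\<forall>z. F z \<in> \<real>\<^sub>\<ge>\<^sub>0 \<and> cmod (F z) \<le> 1) \<and> F x = 1}"

lemma peakD: "F \<in> peak x \<Longrightarrow> F \<in> C0 X" "F \<in> peak x \<Longrightarrow> F z \<in> \<real>\<^sub>\<ge>\<^sub>0"
    "F \<in> peak x \<Longrightarrow> cmod (F z) \<le> 1" "F \<in> peak x \<Longrightarrow> F x = 1"
  by (auto simp: peak_def)

lemma peak_in_neighbourhood:
  assumes "openin X U" "x \<in> U"
  obtains k where "k \<in> peak x" "\<And>z. z \<notin> U \<Longrightarrow> k z = 0"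
proof -
  obtain k where "(\<lambda>x. complex_of_real (k x)) \<in> C0 X" "k x = 1" "\<And>z. 0 \<le> k z" "\<And>z. k z \<le> 1"
      "\<And>z. z \<notin> U \<Longrightarrow> k z = 0"
    using C0_bump[OF X assms] by blast
  then show ?thesis
    using that[of "\<lambda>z. complex_of_real (k z)"] by (auto simp: peak_def)
qed

lemma peak_average:
  assumes "finite G" "G \<noteq> {}" "G \<subseteq> peak x"
  shows "(\<lambda>z. of_real (1 / card G) * (\<Sum>F\<in>G. F z)) \<in> peak x"
proof -
  have card: "card G > 0"
    using assms by (simp add: card_gt_0_iff)
  have "(\<lambda>z. of_real (1 / card G) * (\<Sum>F\<in>G. F z)) \<in> C0 X"
    using assms by (intro C0_cmult C0_sum) (auto dest: peakD)
  moreover have "(\<Sum>F\<in>G. F z) \<in> \<real>\<^sub>\<ge>\<^sub>0" for z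
    using assms(3) by (induction G rule: infinite_finite_induct) (auto intro!: nonneg_Reals_add_I intro: peakD(2))
  then have "of_real (1 / card G) * (\<Sum>F\<in>G. F z) \<in> \<real>\<^sub>\<ge>\<^sub>0" for z
    by (intro nonneg_Reals_mult_I) auto
  moreover have "cmod (\<Sum>F\<in>G. F z) \<le> card G" for z
    using sum_norm_le[of G "\<lambda>F. F z" "\<lambda>F. 1"] assms(3) by (auto dest: peakD)
  then have "cmod (of_real (1 / card G) * (\<Sum>F\<in>G. F z)) \<le> 1" for z
    using card by (simp add: norm_mult norm_divide field_simps)
  moreover have "(\<Sum>F\<in>G. F x) = (\<Sum>F\<in>G. 1)"
    using assms(3) by (intro sum.cong refl peakD) auto
  then have "of_real (1 / card G) * (\<Sum>F\<in>G. F x) = 1"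
    using card by simp
  ultimately show ?thesis
    by (simp add: peak_def)
qed

text \<open>Equality case of the triangle inequality: numbers of modulus at most 1 whose average has
  modulus 1 all have modulus 1.\<close>

lemma norm_T_peak_average:
  assumes G: "finite G" "G \<noteq> {}" "G \<subseteq> peak x"
    and y: "cmod (T (\<lambda>z. of_real (1 / card G) * (\<Sum>F\<in>G. F z)) y) = 1"
  shows "cmod (\<Sum>F\<in>G. T F y) = card G" and "F \<in> G \<Longrightarrow> cmod (T F y) = 1"
proof -
  have card: "card G > 0"
    using G by (simp add: card_gt_0_iff)
  have C0: "F \<in> C0 X" if "F \<in> G" for F
    using that G by (auto dest: peakD)
  have "T (\<lambda>z. of_real (1 / card G) * (\<Sum>F\<in>G. F z)) y = of_real (1 / card G) * T (\<lambda>z. \<Sum>F\<in>G. F z) y"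
    using C0 by (intro T_scale C0_sum)
  also have "T (\<lambda>z. \<Sum>F\<in>G. F z) y = (\<Sum>F\<in>G. T F y)"
    using C0 by (rule T_sum)
  finally have "1 = cmod (of_real (1 / card G) * (\<Sum>F\<in>G. T F y))"
    using y by simp
  then show eq: "cmod (\<Sum>F\<in>G. T F y) = card G"
    using card by (simp add: norm_mult norm_divide field_simps)
  have le: "cmod (T F y) \<le> 1" if "F \<in> G" for F
    using that G by (intro T_le) (auto dest: peakD)
  have "card G \<le> (\<Sum>F\<in>G. cmod (T F y))"
    unfolding eq[symmetric] by (rule norm_sum)
  then have "(\<Sum>F\<in>G. 1 - cmod (T F y)) \<le> 0"
    by (simp add: sum_subtractf)
  moreover have "0 \<le> (\<Sum>F\<in>G. 1 - cmod (T F y))"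
    using le by (intro sum_nonneg) auto
  ultimately have "(\<Sum>F\<in>G. 1 - cmod (T F y)) = 0"
    by simp
  then show "cmod (T F y) = 1" if "F \<in> G"
    using that le G(1) by (subst (asm) sum_nonneg_eq_0_iff) auto
qed

text \<open>The average of finitely many peaking functions peaks too. A point where its image has
  modulus 1 is therefore common to all of them, which is the finite intersection property. Applied
  to pairs, averaging also forces the values at the limit point to coincide.\<close>

lemma common_peak_point:
  assumes x: "x \<in> topspace X"
  shows "\<exists>y\<in>topspace Y. \<forall>F\<in>peak x. \<forall>G\<in>peak x. cmod (T F y) = 1 \<and> T F y = T G y"
proof -
  obtain k where k: "k \<in> peak x"
    using peak_in_neighbourhood[OF openin_topspace x] by blast
  have "\<exists>y\<in>{y \<in> topspace Y. 1 \<le> cmod (T k y)}. \<forall>F\<in>peak x. y \<in> {y \<in> topspace Y. 1 \<le> cmod (T F y)}"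
  proof (rule compactin_finite_intersections)
    show "compactin Y {y \<in> topspace Y. 1 \<le> cmod (T k y)}"
      using k by (intro C0_compactin T_C0 peakD) auto
    show "closedin Y {y \<in> topspace Y. 1 \<le> cmod (T F y)}" if "F \<in> peak x" for F
      using that Y by (intro compactin_imp_closedin C0_compactin T_C0 peakD) auto
    fix G assume G: "finite G" "G \<subseteq> peak x"
    \<comment> \<open>Including \<open>k\<close> places the point in the compact set where \<bar>T
      k\<bar> is at least 1.\<close>
    let ?A = "\<lambda>z. of_real (1 / card (insert k G)) * (\<Sum>F\<in>insert k G. F z)"
    have A: "?A \<in> peak x"
      using G k by (intro peak_average) auto
    obtain y where y: "y \<in> topspace Y" "cmod (T ?A y) = 1"
      using T_attains[OF _ _ _ x, of ?A] peakD[OF A] by blast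
    have "cmod (T F y) = 1" if "F \<in> insert k G" for F
      using norm_T_peak_average(2)[OF _ _ _ y(2) that] G k by auto
    then show "\<exists>y\<in>{y \<in> topspace Y. 1 \<le> cmod (T k y)}. \<forall>F\<in>G. y \<in> {y \<in> topspace Y. 1 \<le> cmod (T F y)}"
      using y(1) by (intro bexI[of _ y]) auto
  qed
  then obtain y where y: "y \<in> topspace Y" and ge: "\<And>F. F \<in> peak x \<Longrightarrow> 1 \<le> cmod (T F y)"
    by auto
  have norm1: "cmod (T F y) = 1" if "F \<in> peak x" for F
    using ge[OF that] T_le[of F y] peakD[OF that] by (simp add: order_antisym)
  have "T F y = T G y" if FG: "F \<in> peak x" "G \<in> peak x" for F G
  proof (cases "F = G")
    case False
    have A: "(\<lambda>z. of_real (1 / card {F, G}) * (\<Sum>F\<in>{F, G}. F z)) \<in> peak x"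
      using FG by (intro peak_average) auto
    have "cmod (\<Sum>F\<in>{F, G}. T F y) = card {F, G}"
      using FG by (intro norm_T_peak_average(1)[OF _ _ _ norm1[OF A]]) auto
    then show ?thesis
      using False norm1[OF FG(1)] norm1[OF FG(2)] by (intro eq_if_norm_sum_eq_2) auto
  qed simp
  then show ?thesis
    using y norm1 by blast
qed

text \<open>All peaking functions at \<open>x\<close> have the same image value at \<open>y\<close>.
  If H takes values in [0, 1] and vanishes at \<open>x\<close>, then with m = min k H both k - m and
  k + H - m = max k H peak at \<open>x\<close>; comparing with k gives T m y = 0 and then T H y = 0.
  Scaling and decomposition extend this to every H with H x = 0, in particular to F - F x *
  k.\<close>

lemma evaluation_point:
  assumes x: "x \<in> topspace X"
  shows "\<exists>y\<in>topspace Y. \<exists>u. cmod u = 1 \<and> (\<forall>F\<in>C0 X. T F y = u * F x)"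
proof -
  obtain y where y: "y \<in> topspace Y" and norm1: "\<And>F. F \<in> peak x \<Longrightarrow> cmod (T F y) = 1"
    and eq: "\<And>F G. F \<in> peak x \<Longrightarrow> G \<in> peak x \<Longrightarrow> T F y = T G y"
    using common_peak_point[OF x] by blast
  obtain k where k: "k \<in> peak x"
    using peak_in_neighbourhood[OF openin_topspace x] by blast
  have unit: "T H y = 0"
    if H: "H \<in> C0 X" "\<And>z. H z \<in> \<real>\<^sub>\<ge>\<^sub>0" "\<And>z. cmod (H z) \<le> 1" "H x = 0" for H
  proof -
    have kr: "0 \<le> Re (k z)" "Im (k z) = 0" "Re (k z) \<le> 1" for z
      using peakD(2)[OF k, of z] peakD(3)[OF k, of z] complex_Re_le_cmod[of "k z"]
      by (auto simp: complex_nonneg_Reals_iff)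
    have Hr: "0 \<le> Re (H z)" "Im (H z) = 0" "Re (H z) \<le> 1" for z
      using H(2,3)[of z] complex_Re_le_cmod[of "H z"] by (auto simp: complex_nonneg_Reals_iff)
    have in_peak: "F \<in> peak x"
      if "F \<in> C0 X" "\<And>z. 0 \<le> Re (F z)" "\<And>z. Re (F z) \<le> 1" "\<And>z. Im (F z) = 0" "F x = 1" for F
      using that by (simp add: peak_def complex_nonneg_Reals_iff cmod_eq_Re)
    define m where "m z = complex_of_real (min (Re (k z)) (Re (H z)))" for z
    have m: "m \<in> C0 X"
    proof (rule C0_dominated[OF _ H(1), of _ 1])
      show "(m \<longlongrightarrow> m z) (atin X z)" if "z \<in> topspace X" for z
        unfolding m_def using that H(1) peakD(1)[OF k] by (intro tendsto_intros C0_tendsto)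
      show "cmod (m z) \<le> 1 * cmod (H z)" for z
        using kr(1)[of z] Hr(1)[of z] complex_Re_le_cmod[of "H z"] by (simp add: m_def)
    qed
    have kH: "(\<lambda>z. k z + H z) \<in> C0 X"
      using peakD(1)[OF k] H(1) by (rule C0_add)
    have "(\<lambda>z. k z - m z) \<in> peak x"
    proof (rule in_peak)
      show "0 \<le> Re (k z - m z)" "Re (k z - m z) \<le> 1" "Im (k z - m z) = 0" for z
        using kr[of z] Hr[of z] by (auto simp: m_def)
      show "k x - m x = 1"
        using peakD(4)[OF k] H(4) by (simp add: m_def)
    qed (intro C0_diff peakD(1)[OF k] m)
    from eq[OF this k] have Tm: "T m y = 0"
      using T_diff[OF peakD(1)[OF k] m] by simp
    have "(\<lambda>z. k z + H z - m z) \<in> peak x"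
    proof (rule in_peak)
      show "0 \<le> Re (k z + H z - m z)" "Re (k z + H z - m z) \<le> 1" "Im (k z + H z - m z) = 0" for z
        using kr[of z] Hr[of z] by (auto simp: m_def min_def)
      show "k x + H x - m x = 1"
        using peakD(4)[OF k] H(4) by (simp add: m_def)
    qed (intro C0_diff kH m)
    from eq[OF this k] show ?thesis
      using T_diff[OF kH m] T_add[OF peakD(1)[OF k] H(1)] Tm by simp
  qed
  have pos: "T H y = 0" if H: "H \<in> C0 X" "\<And>z. H z \<in> \<real>\<^sub>\<ge>\<^sub>0" "H x = 0" for H
  proof -
    obtain b where b: "b > 0" "\<And>z. cmod (H z) \<le> b"
      using C0_bounded[OF H(1)] by blast
    have "T (\<lambda>z. of_real (1 / b) * H z) y = 0"
      using b H by (intro unit C0_cmult nonneg_Reals_mult_I) (auto simp: norm_mult norm_divide)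
    then have "of_real (1 / b) * T H y = 0"
      by (simp only: T_scale[OF H(1)])
    then show ?thesis
      using b(1) by simp
  qed
  have zero: "T H y = 0" if H: "H \<in> C0 X" "H x = 0" for H
  proof -
    obtain p :: "nat \<Rightarrow> 'a \<Rightarrow> complex" where p: "\<And>k. p k \<in> C0 X" "\<And>k x. p k x \<in> \<real>\<^sub>\<ge>\<^sub>0"
        "\<And>k x. cmod (p k x) \<le> cmod (H x)" "H = (\<lambda>x. \<Sum>k<4. \<i> ^ k * p k x)"
      using C0_nonneg_decomposition[OF H(1)] by blast
    have "T (p k) y = 0" for k
      using p(1,2) p(3)[of k x] H(2) by (intro pos) auto
    then show ?thesis
      by (subst p(4)) (simp add: T_sum T_scale C0_cmult p(1))
  qed
  have "T F y = T k y * F x" if F: "F \<in> C0 X" for F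
  proof -
    have "T (\<lambda>z. F z - F x * k z) y = 0"
      using F k by (intro zero C0_diff C0_cmult) (auto dest: peakD)
    then show ?thesis
      using T_diff[OF F C0_cmult[OF peakD(1)[OF k]]] T_scale[OF peakD(1)[OF k]] by simp
  qed
  then show ?thesis
    using y norm1[OF k] by blast
qed

text \<open>Every value of \<open>F\<close> is visible, up to a unimodular factor, at some
  evaluation point, so \<open>F\<close> itself is 0. This drives the density argument.\<close>

lemma zero_on_evaluation_points:
  assumes F: "F \<in> C0 X"
    and zero: "\<And>y u x. y \<in> topspace Y \<Longrightarrow> x \<in> topspace X \<Longrightarrow> cmod u = 1 \<Longrightarrow>
      (\<forall>F\<in>C0 X. T F y = u * F x) \<Longrightarrow> T F y = 0"
  shows "T F y = 0"
proof -
  have "F x = 0" for x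
  proof (cases "x \<in> topspace X")
    case True
    obtain y u where yu: "y \<in> topspace Y" "cmod u = 1" "\<forall>F\<in>C0 X. T F y = u * F x"
      using evaluation_point[OF True] by blast
    then have "u * F x = 0"
      using zero[OF yu(1) True yu(2,3)] F by simp
    then show ?thesis
      using yu(2) by auto
  qed (use C0_outside[OF F] in auto)
  then have "F = (\<lambda>x. 0 * F x)"
    by auto
  then show ?thesis
    using T_scale[OF F, of 0 y] by simp
qed

text \<open>By regularity, a point outside the closure of \<open>E\<close> would give a nonzero T F
  vanishing on \<open>E\<close>. For a point in the closure, nearby evaluation points match finitely
  many moduli approximately, and compactness supplies one \<open>x\<close> matching all of them
  exactly. Applied to F - F x * k, equality of moduli yields the evaluation formula.\<close>

lemma every_point_evaluates:
  assumes y: "y \<in> topspace Y"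
  shows "\<exists>x\<in>topspace X. \<exists>u. cmod u = 1 \<and> (\<forall>F\<in>C0 X. T F y = u * F x)"
proof -
  define E where "E = {y \<in> topspace Y. \<exists>x\<in>topspace X. \<exists>u. cmod u = 1 \<and> (\<forall>F\<in>C0 X. T F y = u * F x)}"
  have dense: "y \<in> Y closure_of E"
  proof (rule ccontr)
    assume "y \<notin> Y closure_of E"
    then obtain F where F: "F \<in> C0 X" "\<forall>z\<in>Y closure_of E. T F z = 0" "T F y \<noteq> 0"
      using T_regular[of "Y closure_of E" y] y by auto
    have E: "E \<subseteq> Y closure_of E"
      by (rule closure_of_subset) (auto simp: E_def)
    have "T F y = 0"
    proof (rule zero_on_evaluation_points[OF F(1)])
      fix z u x
      assume "z \<in> topspace Y" "x \<in> topspace X" "cmod u = 1" "\<forall>F\<in>C0 X. T F z = u * F x"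
      then have "z \<in> E"
        unfolding E_def by blast
      then show "T F z = 0"
        using F(2) E by blast
    qed
    then show False
      using F(3) by simp
  qed
  obtain F0 where F0: "F0 \<in> C0 X" "T F0 y \<noteq> 0"
    using T_regular[of "{}" y] y by auto
  define c where "c = cmod (T F0 y) / 2"
  have c: "0 < c" "c < cmod (T F0 y)"
    using F0(2) by (auto simp: c_def)
  \<comment> \<open>One closed condition for each function and each tolerance: finitely many can be
    met at once by an \<open>x\<close> belonging to a point of \<open>E\<close> near
    \<open>y\<close>.\<close>
  define C where "C = (\<lambda>(F, e). {x \<in> topspace X. \<bar>cmod (F x) - cmod (T F y)\<bar> \<le> e})"
  have "\<exists>x\<in>{x \<in> topspace X. c \<le> cmod (F0 x)}. \<forall>i\<in>C0 X \<times> {0<..}. x \<in> C i"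
  proof (rule compactin_finite_intersections)
    show "compactin X {x \<in> topspace X. c \<le> cmod (F0 x)}"
      using F0(1) c(1) by (rule C0_compactin)
    show "closedin X (C i)" if i: "i \<in> C0 X \<times> {0<..}" for i
    proof -
      obtain F e where Fe: "i = (F, e)" "F \<in> C0 X"
        using i by auto
      have "continuous_map X euclideanreal (\<lambda>x. \<bar>cmod (F x) - cmod (T F y)\<bar>)"
        using Fe(2) unfolding continuous_map_atin limitin_canonical_iff
        by (intro ballI tendsto_intros C0_tendsto)
      then have "closedin X {x \<in> topspace X. \<bar>cmod (F x) - cmod (T F y)\<bar> \<in> {..e}}"
        by (rule closedin_continuous_map_preimage) auto
      then show ?thesis
        by (simp add: C_def Fe(1))
    qed
    fix J :: "(('a \<Rightarrow> complex) \<times> real) set"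
    assume J: "finite J" "J \<subseteq> C0 X \<times> {0<..}"
    define V where "V = (\<lambda>(F, e). {z \<in> topspace Y. \<bar>cmod (T F z) - cmod (T F y)\<bar> < e})"
    \<comment> \<open>The extra pair \<open>(F0, c)\<close> keeps \<bar>F0 x\<bar> above 2 * c - c =
      c, hence \<open>x\<close> in the compact set.\<close>
    have V: "openin Y (V i)" if i: "i \<in> insert (F0, c) J" for i
    proof -
      obtain F e where Fe: "i = (F, e)" "F \<in> C0 X"
        using i J F0(1) by auto
      have "continuous_map Y euclideanreal (\<lambda>z. \<bar>cmod (T F z) - cmod (T F y)\<bar>)"
        using T_C0[OF Fe(2)] unfolding continuous_map_atin limitin_canonical_iff
        by (intro ballI tendsto_intros C0_tendsto)
      then have "openin Y {z \<in> topspace Y. \<bar>cmod (T F z) - cmod (T F y)\<bar> \<in> {..<e}}"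
        by (rule openin_continuous_map_preimage) auto
      then show ?thesis
        by (simp add: V_def Fe(1))
    qed
    have "openin Y (\<Inter>i\<in>insert (F0, c) J. V i)"
      using J V by (intro openin_INT2) auto
    moreover have "y \<in> (\<Inter>i\<in>insert (F0, c) J. V i)"
      using y J c by (auto simp: V_def)
    ultimately obtain z where z: "z \<in> E" "z \<in> (\<Inter>i\<in>insert (F0, c) J. V i)"
      using dense unfolding in_closure_of by blast
    obtain x u where xu: "x \<in> topspace X" "cmod u = 1" "\<forall>F\<in>C0 X. T F z = u * F x"
      using z(1) by (auto simp: E_def)
    have norm_eq: "cmod (T F z) = cmod (F x)" if "F \<in> C0 X" for F
      using xu that by (simp add: norm_mult)
    have "\<bar>cmod (F0 x) - 2 * c\<bar> < c"
      using z(2) norm_eq[OF F0(1)] by (auto simp: V_def c_def)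
    then have "c \<le> cmod (F0 x)"
      by linarith
    moreover have "x \<in> C i" if i: "i \<in> J" for i
    proof -
      obtain F e where Fe: "i = (F, e)" "F \<in> C0 X"
        using i J by auto
      have "z \<in> V i"
        using z(2) i by blast
      then show ?thesis
        using xu(1) norm_eq[OF Fe(2)] by (simp add: C_def V_def Fe(1))
    qed
    ultimately show "\<exists>x\<in>{x \<in> topspace X. c \<le> cmod (F0 x)}. \<forall>i\<in>J. x \<in> C i"
      using xu(1) by blast
  qed
  then obtain x where x: "x \<in> topspace X" and xC: "\<And>F e. F \<in> C0 X \<Longrightarrow> e > 0 \<Longrightarrow> x \<in> C (F, e)"
    by auto
  have norm_eq: "cmod (T F y) = cmod (F x)" if "F \<in> C0 X" for F
  proof -
    have "\<bar>cmod (F x) - cmod (T F y)\<bar> \<le> e" if "e > 0" for e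
      using xC[OF \<open>F \<in> C0 X\<close> that] by (simp add: C_def)
    then have "\<bar>cmod (F x) - cmod (T F y)\<bar> \<le> 0"
      by (rule field_le_epsilon) simp
    then show ?thesis
      by simp
  qed
  obtain k where k: "k \<in> peak x"
    using peak_in_neighbourhood[OF openin_topspace x] by blast
  have "T F y = T k y * F x" if F: "F \<in> C0 X" for F
  proof -
    have "cmod (T (\<lambda>z. F z - F x * k z) y) = 0"
      using norm_eq[OF C0_diff[OF F C0_cmult[OF peakD(1)[OF k]]]] peakD(4)[OF k] by simp
    then show ?thesis
      using T_diff[OF F C0_cmult[OF peakD(1)[OF k]]] T_scale[OF peakD(1)[OF k]] by simp
  qed
  moreover have "cmod (T k y) = 1"
    using norm_eq[OF peakD(1)[OF k]] peakD(4)[OF k] by simp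
  ultimately show ?thesis
    using x by blast
qed

text \<open>The map \<open>\<phi>\<close> matches the nonvanishing set of T F with that of F. Bump
  functions make such sets a base of \<open>X\<close>, regularity makes them a base of
  \<open>Y\<close>; this gives continuity and openness. Injectivity is regularity against a single
  point.\<close>

theorem weighted_composition:
  obtains h \<phi> where "continuous_map Y euclidean h" "\<And>y. y \<in> topspace Y \<Longrightarrow> cmod (h y) = 1"
    "homeomorphic_map Y X \<phi>" "\<And>F y. F \<in> C0 X \<Longrightarrow> y \<in> topspace Y \<Longrightarrow> T F y = h y * F (\<phi> y)"
proof -
  have "\<exists>x u. y \<in> topspace Y \<longrightarrow> x \<in> topspace X \<and> cmod u = 1 \<and> (\<forall>F\<in>C0 X. T F y = u * F x)" for y
    using every_point_evaluates by blast
  then obtain \<phi> h where \<phi>: "\<And>y. y \<in> topspace Y \<Longrightarrow> \<phi> y \<in> topspace X"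
    and h: "\<And>y. y \<in> topspace Y \<Longrightarrow> cmod (h y) = 1"
    and T: "\<And>y F. y \<in> topspace Y \<Longrightarrow> F \<in> C0 X \<Longrightarrow> T F y = h y * F (\<phi> y)"
    by metis
  have T0: "T F y = 0 \<longleftrightarrow> F (\<phi> y) = 0" if "y \<in> topspace Y" "F \<in> C0 X" for y F
    using T[OF that] h[OF that(1)] by auto
  have point: "x = \<phi> y"
    if x: "x \<in> topspace X" and y: "y \<in> topspace Y" and u: "cmod u = 1" "\<forall>F\<in>C0 X. T F y = u * F x" for x y u
  proof (rule ccontr)
    assume "x \<noteq> \<phi> y"
    then obtain U where U: "openin X U" "x \<in> U" "\<phi> y \<notin> U"
      using X(2) \<phi>[OF y] x unfolding Hausdorff_space_def disjnt_iff by metis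
    obtain k where k: "k \<in> peak x" "\<And>z. z \<notin> U \<Longrightarrow> k z = 0"
      using peak_in_neighbourhood[OF U(1,2)] by blast
    have "T k y = 0"
      using T0[OF y peakD(1)[OF k(1)]] k(2) U(3) by simp
    then show False
      using u peakD(1)[OF k(1)] peakD(4)[OF k(1)] by auto
  qed
  have "inj_on \<phi> (topspace Y)"
  proof (rule inj_onI, rule ccontr)
    fix y z assume yz: "y \<in> topspace Y" "z \<in> topspace Y" "\<phi> y = \<phi> z" "y \<noteq> z"
    have "closedin Y {z}"
      using Y yz(2) by (simp add: closedin_Hausdorff_singleton)
    then obtain F where "F \<in> C0 X" "T F z = 0" "T F y \<noteq> 0"
      using T_regular[of "{z}" y] yz by auto
    then show False
      using T0 yz by metis
  qed
  moreover have surj: "\<phi> ` topspace Y = topspace X"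
    using \<phi> evaluation_point point by (auto simp: image_iff) metis
  moreover have cont: "continuous_map Y X \<phi>"
    unfolding continuous_map_def
  proof (intro conjI allI impI)
    show "\<phi> \<in> topspace Y \<rightarrow> topspace X"
      using \<phi> by auto
    fix U assume U: "openin X U"
    show "openin Y {y \<in> topspace Y. \<phi> y \<in> U}"
    proof (subst openin_subopen, intro ballI)
      fix y assume "y \<in> {y \<in> topspace Y. \<phi> y \<in> U}"
      then have y: "y \<in> topspace Y" "\<phi> y \<in> U"
        by auto
      obtain k where k: "k \<in> peak (\<phi> y)" "\<And>z. z \<notin> U \<Longrightarrow> k z = 0"
        using peak_in_neighbourhood[OF U y(2)] by blast
      have "continuous_map Y euclidean (T k)"
        using T_C0[OF peakD(1)[OF k(1)]] by (simp add: C0_def)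
      then have "openin Y {z \<in> topspace Y. T k z \<in> - {0}}"
        by (rule openin_continuous_map_preimage) auto
      moreover have "{z \<in> topspace Y. T k z \<in> - {0}} \<subseteq> {y \<in> topspace Y. \<phi> y \<in> U}"
        using T0[OF _ peakD(1)[OF k(1)]] k(2) by auto
      moreover have "y \<in> {z \<in> topspace Y. T k z \<in> - {0}}"
        using y(1) T0[OF y(1) peakD(1)[OF k(1)]] peakD(4)[OF k(1)] by simp
      ultimately show "\<exists>V. openin Y V \<and> y \<in> V \<and> V \<subseteq> {y \<in> topspace Y. \<phi> y \<in> U}"
        by blast
    qed
  qed
  moreover have "open_map Y X \<phi>"
    unfolding open_map_def
  proof (intro allI impI)
    fix V assume V: "openin Y V"
    show "openin X (\<phi> ` V)"
    proof (subst openin_subopen, intro ballI)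
      fix x assume "x \<in> \<phi> ` V"
      then obtain y where y: "y \<in> V" "x = \<phi> y"
        by blast
      have yY: "y \<in> topspace Y"
        using V y(1) openin_subset by blast
      obtain F where F: "F \<in> C0 X" "\<forall>z\<in>topspace Y - V. T F z = 0" "T F y \<noteq> 0"
        using T_regular[of "topspace Y - V" y] V y(1) yY by auto
      have "continuous_map X euclidean F"
        using F(1) by (simp add: C0_def)
      then have "openin X {z \<in> topspace X. F z \<in> - {0}}"
        by (rule openin_continuous_map_preimage) auto
      moreover have "x \<in> {z \<in> topspace X. F z \<in> - {0}}"
        using T0[OF yY F(1)] F(3) \<phi>[OF yY] y(2) by simp
      moreover have "{z \<in> topspace X. F z \<in> - {0}} \<subseteq> \<phi> ` V"
      proof
        fix z assume "z \<in> {z \<in> topspace X. F z \<in> - {0}}"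
        then obtain w where "w \<in> topspace Y" "z = \<phi> w" "F (\<phi> w) \<noteq> 0"
          using surj by force
        then show "z \<in> \<phi> ` V"
          using T0[OF _ F(1)] F(2) by blast
      qed
      ultimately show "\<exists>W. openin X W \<and> x \<in> W \<and> W \<subseteq> \<phi> ` V"
        by blast
    qed
  qed
  ultimately have "homeomorphic_map Y X \<phi>"
    by (intro bijective_open_imp_homeomorphic_map)
  moreover have "continuous_map Y euclidean h"
    unfolding continuous_map_atin limitin_canonical_iff
  proof
    fix y assume y: "y \<in> topspace Y"
    obtain k where k: "k \<in> peak (\<phi> y)"
      using peak_in_neighbourhood[OF openin_topspace \<phi>[OF y]] by blast
    have "continuous_map Y euclidean (k \<circ> \<phi>)"
      using cont peakD(1)[OF k] by (auto simp: C0_def intro: continuous_map_compose)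
    then have lim_k: "((\<lambda>z. k (\<phi> z)) \<longlongrightarrow> 1) (atin Y y)"
      using y peakD(4)[OF k] by (auto simp: continuous_map_atin o_def)
    \<comment> \<open>Near \<open>y\<close> the function \<open>h\<close> is a quotient of
      continuous functions, as the denominator tends to 1.\<close>
    have "((\<lambda>z. T k z / k (\<phi> z)) \<longlongrightarrow> T k y / 1) (atin Y y)"
      using C0_tendsto[OF T_C0[OF peakD(1)[OF k]] y] lim_k by (intro tendsto_divide) auto
    moreover have "eventually (\<lambda>z. k (\<phi> z) \<noteq> 0) (atin Y y)"
      using lim_k by (rule tendsto_imp_eventually_ne) simp
    moreover have "eventually (\<lambda>z. z \<in> topspace Y) (atin Y y)"
      using y by (auto simp: eventually_atin)
    then have "eventually (\<lambda>z. T k z / k (\<phi> z) = h z) (atin Y y)"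
      using \<open>eventually (\<lambda>z. k (\<phi> z) \<noteq> 0) (atin Y y)\<close>
      by eventually_elim (simp add: T peakD(1)[OF k])
    ultimately show "(h \<longlongrightarrow> h y) (atin Y y)"
      using T[OF y peakD(1)[OF k]] peakD(4)[OF k] by (simp add: tendsto_cong)
  qed
  ultimately show ?thesis
    using that h T by blast
qed

end

section \<open>From the polynomial to the linear map, and back\<close>

theorem theorem4p2:
  fixes X :: "'a topology" and Y :: "'b topology" and n :: nat
    and P :: "('a \<Rightarrow> complex) \<Rightarrow> 'b \<Rightarrow> complex"
  assumes "locally_compact_space X" and "Hausdorff_space X"
    and "locally_compact_space Y" and "Hausdorff_space Y"
    and "n \<ge> 1"
    and "homogeneous_polynomial n (C0 X) (C0 Y) P"
    and "orthogonally_additive X P"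
    and "\<forall>f\<in>C0_pos X. sup_norm Y (P f) = sup_norm X f ^ n"
    and "regular_subset Y (P ` C0 X)"
  shows "\<exists>(h :: 'b \<Rightarrow> complex) (\<phi> :: 'b \<Rightarrow> 'a).
           continuous_map Y euclidean h \<and> (\<forall>y\<in>topspace Y. cmod (h y) = 1) \<and>
           homeomorphic_map Y X \<phi> \<and>
           (\<forall>f\<in>C0 X. \<forall>y\<in>topspace Y. P f y = h y * f (\<phi> y) ^ n)"
proof -
  have n: "n \<ge> 1" and isometry: "\<And>f. f \<in> C0_pos X \<Longrightarrow> sup_norm Y (P f) = sup_norm X f ^ n"
    using assms by auto
  obtain L where ml: "multilinear_op n (C0 X) (C0 Y) L" and sy: "symmetric_op n (C0 X) L"
    and P: "\<And>f. f \<in> C0 X \<Longrightarrow> P f = L (\<lambda>i\<in>{..<n}. f)"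
    using assms(6) by (auto simp: homogeneous_polynomial_def)
  have LC0: "L u \<in> C0 Y" if "u \<in> {..<n} \<rightarrow>\<^sub>E C0 X" for u
    using ml that by (simp add: multilinear_op_def)
  have PC0: "P f \<in> C0 Y" if "f \<in> C0 X" for f
    using assms(9) that by (auto simp: regular_subset_def)
  have restrict_C0: "restrict u {..<n} \<in> {..<n} \<rightarrow>\<^sub>E C0 X" if "\<And>i. i < n \<Longrightarrow> u i \<in> C0 X" for u
    using that by auto
  have upd: "restrict (u(j := f)) {..<n} = (restrict u {..<n})(j := f)" if "j < n"
    for u :: "nat \<Rightarrow> 'a \<Rightarrow> complex" and j f
    using that by (auto simp: fun_eq_iff)
  have form: "orthogonal_C0_form X n (\<lambda>u. L (restrict u {..<n}) y)" for y
  proof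
    fix u v :: "nat \<Rightarrow> 'a \<Rightarrow> complex" and f g :: "'a \<Rightarrow> complex" and j c p
    show "L (restrict u {..<n}) y = L (restrict v {..<n}) y" if "\<And>i. i < n \<Longrightarrow> u i = v i"
      using that by (metis lessThan_iff restrict_ext)
    show "L (restrict (u(j := \<lambda>x. f x + g x)) {..<n}) y =
        L (restrict (u(j := f)) {..<n}) y + L (restrict (u(j := g)) {..<n}) y"
      if "\<And>i. i < n \<Longrightarrow> u i \<in> C0 X" "j < n" "f \<in> C0 X" "g \<in> C0 X"
      using ml restrict_C0[OF that(1)] that(2-) by (simp add: multilinear_op_def upd)
    show "L (restrict (u(j := \<lambda>x. c * f x)) {..<n}) y = c * L (restrict (u(j := f)) {..<n}) y"
      if "\<And>i. i < n \<Longrightarrow> u i \<in> C0 X" "j < n" "f \<in> C0 X"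
      using ml restrict_C0[OF that(1)] that(2-) by (simp add: multilinear_op_def upd)
    show "L (restrict (u \<circ> p) {..<n}) y = L (restrict u {..<n}) y"
      if "\<And>i. i < n \<Longrightarrow> u i \<in> C0 X" "p permutes {..<n}"
    proof -
      have "restrict (u \<circ> p) {..<n} = restrict u {..<n} \<circ> p"
        using permutes_in_image[OF that(2)] by (auto simp: fun_eq_iff restrict_def)
      then show ?thesis
        using sy restrict_C0[OF that(1)] that(2) by (simp add: symmetric_op_def)
    qed
    show "L (\<lambda>i\<in>{..<n}. \<lambda>x. f x + g x) y = L (\<lambda>i\<in>{..<n}. f) y + L (\<lambda>i\<in>{..<n}. g) y"
      if "f \<in> C0 X" "g \<in> C0 X" "\<And>x. f x * g x = 0"
    proof -
      have "P (\<lambda>x. f x + g x) = (\<lambda>y. P f y + P g y)"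
        using assms(7) that by (simp add: orthogonally_additive_def)
      then show ?thesis
        by (simp only: P[OF that(1)] P[OF that(2)] P[OF C0_add[OF that(1,2)]])
    qed
    show "cmod (L (\<lambda>i\<in>{..<n}. f) y) \<le> 1"
      if f: "f \<in> C0 X" "\<And>x. f x \<in> \<real>\<^sub>\<ge>\<^sub>0" "\<And>x. cmod (f x) \<le> 1"
    proof -
      have "cmod (P f y) \<le> sup_norm Y (P f)"
        using PC0[OF f(1)] by (rule cmod_le_sup_norm)
      also have "\<dots> = sup_norm X f ^ n"
        using f by (intro isometry) (simp add: C0_pos_def)
      also have "\<dots> \<le> 1"
        \<comment> \<open>The arbitrary point only serves to give 0 \<le> sup_norm X f, also when
          the space is empty.\<close>
        using f cmod_le_sup_norm[OF f(1), of undefined]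
        by (intro power_le_one sup_norm_le) (auto intro: order_trans[OF norm_ge_zero])
      finally show ?thesis
        by (simp add: P f(1))
    qed
  qed (use n in auto)
  \<comment> \<open>Written through \<open>L\<close>, so that T F is at once an element of
    \<open>C0 Y\<close>; linearity is then checked at each \<open>y\<close> through
    \<open>T_eq\<close>.\<close>
  define T where "T F = L (restrict (slot_tuple n (\<lambda>x. complex_of_real (root (2 * n) (cmod (F x)))) F) {..<n})" for F
  have T_eq: "T F y = orthogonal_C0_form.linearization n (\<lambda>u. L (restrict u {..<n}) y) F" for F y
    by (simp add: T_def orthogonal_C0_form.linearization_def[OF form])
  have TP: "T (\<lambda>x. f x ^ n) = P f" if "f \<in> C0 X" for f
    using that by (auto simp: T_eq orthogonal_C0_form.linearization_power[OF form] P)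
  \<comment> \<open>A nonnegative F is the n-th power of its nonnegative root f, so T F = P f. This
    is how the norm condition on \<open>P\<close> reaches \<open>T\<close>.\<close>
  have T_root: "\<exists>f\<in>C0_pos X. T F = P f \<and> sup_norm X f \<le> 1 \<and> (\<forall>x. F x = 1 \<longrightarrow> f x = 1)"
    if F: "F \<in> C0 X" "\<And>x. F x \<in> \<real>\<^sub>\<ge>\<^sub>0" "\<And>x. cmod (F x) \<le> 1" for F
  proof -
    define f where "f x = complex_of_real (root n (cmod (F x)))" for x
    have f: "f \<in> C0 X"
      unfolding f_def using F(1) n by (rule C0_root)
    have "complex_of_real (cmod (F x)) = F x" for x
      using F(2)[of x] by (auto elim!: nonneg_Reals_cases)
    then have "f x ^ n = F x" for x
      using n by (simp add: f_def real_root_pow_pos2 flip: of_real_power)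
    then have "T F = P f"
      using TP[OF f] by simp
    moreover have "f \<in> C0_pos X"
      using f by (simp add: C0_pos_def f_def real_root_ge_zero)
    moreover have "sup_norm X f \<le> 1"
      using F(3) n by (intro sup_norm_le) (simp_all add: f_def)
    ultimately show ?thesis
      using n by (intro bexI[of _ f]) (auto simp: f_def)
  qed
  interpret positive_isometry X Y T
  proof
    show "T F \<in> C0 Y" if F: "F \<in> C0 X" for F
    proof -
      have "slot_tuple n (\<lambda>x. complex_of_real (root (2 * n) (cmod (F x)))) F i \<in> C0 X" for i
        using F n by (intro slot_tuple_C0 root_norm_C0) (simp_all add: root_norm_power)
      then show ?thesis
        unfolding T_def by (intro LC0 restrict_C0)
    qed
    show "T (\<lambda>x. F x + G x) y = T F y + T G y" if "F \<in> C0 X" "G \<in> C0 X" for F G y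
      using that by (simp add: T_eq orthogonal_C0_form.linearization_add[OF form])
    show "T (\<lambda>x. c * F x) y = c * T F y" if "F \<in> C0 X" for F c y
      using that by (simp add: T_eq orthogonal_C0_form.linearization_scale[OF form])
    show "cmod (T F y) \<le> 1" if F: "F \<in> C0 X" "\<And>x. F x \<in> \<real>\<^sub>\<ge>\<^sub>0" "\<And>x. cmod (F x) \<le> 1" for F y
    proof -
      obtain f where f: "f \<in> C0_pos X" "T F = P f" "sup_norm X f \<le> 1"
        using T_root[OF F] by blast
      then have fC0: "f \<in> C0 X"
        by (simp add: C0_pos_def)
      have "cmod (P f y) \<le> sup_norm X f ^ n"
        using cmod_le_sup_norm[OF PC0[OF fC0], of y] isometry[OF f(1)] by simp
      also have "\<dots> \<le> 1"
        using f(3) order_trans[OF norm_ge_zero cmod_le_sup_norm[OF fC0]] by (intro power_le_one) auto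
      finally show ?thesis
        using f(2) by simp
    qed
    show "\<exists>y\<in>topspace Y. cmod (T F y) = 1"
      if F: "F \<in> C0 X" "\<And>x. F x \<in> \<real>\<^sub>\<ge>\<^sub>0" "\<And>x. cmod (F x) \<le> 1" and x: "x \<in> topspace X" "F x = 1" for F x
    proof -
      obtain f where f: "f \<in> C0_pos X" "T F = P f" "sup_norm X f \<le> 1" "f x = 1"
        using T_root[OF F] x(2) by blast
      then have fC0: "f \<in> C0 X"
        by (simp add: C0_pos_def)
      have "sup_norm X f = 1"
        using f(3,4) cmod_le_sup_norm[OF fC0, of x] by simp
      then have "sup_norm Y (P f) = 1"
        using isometry[OF f(1)] by simp
      then show ?thesis
        using sup_norm_attained[OF PC0[OF fC0]] f(2) by (metis zero_less_one)
    qed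
    show "\<exists>F\<in>C0 X. (\<forall>z\<in>Z. T F z = 0) \<and> T F y \<noteq> 0" if Z: "closedin Y Z" "y \<in> topspace Y - Z" for Z y
    proof -
      obtain f where f: "f \<in> C0 X" "\<forall>z\<in>Z. P f z = 0" "P f y \<noteq> 0"
        using assms(9) Z unfolding regular_subset_def by blast
      moreover have "(\<lambda>x. f x ^ n) \<in> C0 X"
        using C0_power[OF f(1), of "n - 1"] n by simp
      ultimately show ?thesis
        using TP[OF f(1)] by (intro bexI[of _ "\<lambda>x. f x ^ n"]) auto
    qed
  qed (use assms in auto)
  obtain h \<phi> where h\<phi>: "continuous_map Y euclidean h" "\<And>y. y \<in> topspace Y \<Longrightarrow> cmod (h y) = 1"
      "homeomorphic_map Y X \<phi>" "\<And>F y. F \<in> C0 X \<Longrightarrow> y \<in> topspace Y \<Longrightarrow> T F y = h y * F (\<phi> y)"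
    using weighted_composition by blast
  have "P f y = h y * f (\<phi> y) ^ n" if f: "f \<in> C0 X" and y: "y \<in> topspace Y" for f y
    using h\<phi>(4)[of "\<lambda>x. f x ^ n" y] TP[OF f] C0_power[OF f, of "n - 1"] n y by simp
  then show ?thesis
    using h\<phi> by blast
qed

end
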